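(* Let $\lambda\in\mathbb C$ with $|\lambda|>1$. Then $F^{(\lambda)}$ is a shift-invariant predual of $\ell_1(\mathbb Z)$, and $F^{(\lambda)}$ consists exactly of those $x\in\ell_\infty(\mathbb Z)$ which, under the canonical identification of $\ell_\infty(\mathbb Z)$ with $C(\beta\mathbb Z)$, satisfy $$x(\mathcal U)=\begin{cases}\lambda^{-k}x(t),& \mathcal U\in X^{(k)}_t,\ k\ge 1,\ t\in\mathbb Z;\\ 0,&\mathcal U\in X^{(\infty)}.\end{cases}$$
   Context: Scalars are complex. Write $\langle x,a\rangle=\sum_{n}x(n)a(n)$ for $x\in\ell_\infty(\mathbb Z)$, $a\in\ell_1(\mathbb Z)$. For a closed subspace $F\subseteq\ell_\infty(\mathbb Z)$ let $\iota_F:\ell_1(\mathbb Z)\to F^*$ be $\iota_F(a)(x)=\langle x,a\rangle$. $F$ is a concrete predual of $\ell_1(\mathbb Z)$ if $\iota_F$ is an isomorphism of Banach spaces (a linear homeomorphism onto $F^*$, not assumed isometric). The bilateral shift on $\ell_\infty(\mathbb Z)$ is $\sigma(x)(n)=x(n-1)$. A shift-invariant predual of $\ell_1(\mathbb Z)$ is a concrete predual $F$ with $\sigma(F)=F$. For $n\ge 0$ let $b(n)$ be the number of ones in the binary expansion of $n$; for $n<0$ set $b(n)=-\infty$. Define $x_0=x_0^{(\lambda)}\in\ell_\infty(\mathbb Z)$ by $x_0(n)=\lambda^{-b(n)}$ for $n\geq 0$ and $x_0(n)=0$ for $n<0$ (the convention being that $\lambda^{-b(n)}=0$ when $b(n)=-\infty$).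 Let $F^{(\lambda)}$ be the closed linear span in $\ell_\infty(\mathbb Z)$ of all bilateral shifts $\sigma^m(x_0)$, $m\in\mathbb Z$. $\beta\mathbb Z$ is the Stone–Čech compactification of $\mathbb Z$, regarded as the space of ultrafilters on $\mathbb Z$; $\mathbb Z^*=\beta\mathbb Z\setminus\mathbb Z$ is the set of non-principal ultrafilters. For $x\in\ell_\infty(\mathbb Z)$ put $x(\mathcal U)=\lim_{n\to\mathcal U}x(n)$. For $k\ge1$, $t\in\mathbb Z$, $$X^{(k)}_t=\{\mathcal U\in\mathbb Z^*:\forall m>0,\ \{2^{n_1}+\cdots+2^{n_k}+t: m<n_1<\cdots<n_k\}\in\mathcal U\},$$ and $X^{(\infty)}=\mathbb Z^*\setminus\bigcup_{t\in\mathbb Z,k\ge1}X^{(k)}_t$. *)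

theory Defs
  imports "HOL-Analysis.Analysis"
begin

text \<open>
  The integers carry the discrete topology, so \<^typ>\<open>int \<Rightarrow>\<^sub>C complex\<close> is the space of all
  bounded two-sided complex sequences, with the supremum norm.
\<close>

type_synonym linf = "int \<Rightarrow>\<^sub>C complex"

lemma bcontfun_int_iff: "(x :: int \<Rightarrow> complex) \<in> bcontfun \<longleftrightarrow> bounded (range x)"
  by (simp add: bcontfun_def)

definition cscale :: "complex \<Rightarrow> linf \<Rightarrow> linf" where
  "cscale c x = Bcontfun (\<lambda>n. c * x n)"

lemma cscale_apply: "cscale c x n = c * x n"
proof -
  obtain B where "\<And>n. norm (x n) \<le> B"
    using bounded_apply_bcontfun[of x] by (auto simp: bounded_iff)
  then have "\<And>n. norm (c * x n) \<le> norm c * B"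
    by (simp add: norm_mult mult_left_mono)
  then have "(\<lambda>n. c * x n) \<in> bcontfun"
    unfolding bcontfun_int_iff bounded_iff by blast
  then show ?thesis by (simp add: cscale_def Bcontfun_inverse)
qed

interpretation linf: vector_space cscale
  by unfold_locales
    (auto intro!: bcontfun_eqI simp: cscale_apply plus_bcontfun.rep_eq algebra_simps)

lemma norm_cscale: "norm (cscale c x) = norm c * norm x"
proof -
  have *: "norm (cscale d y) \<le> norm d * norm y" for d y
    by (rule norm_bound) (simp add: cscale_apply norm_mult mult_left_mono norm_bounded)
  show ?thesis
  proof (cases "c = 0")
    case False
    have "norm x = norm (cscale (inverse c) (cscale c x))"
      using False by simp
    also have "\<dots> \<le> inverse (norm c) * norm (cscale c x)"
      using *[of "inverse c" "cscale c x"] by (simp add: norm_inverse)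
    finally have "norm c * norm x \<le> norm (cscale c x)"
      using False by (simp add: field_simps)
    with *[of c x] show ?thesis by simp
  qed simp
qed

definition ell1 :: "(int \<Rightarrow> complex) set" where
  "ell1 = {a. (\<lambda>n. norm (a n)) summable_on UNIV}"

definition ell1_norm :: "(int \<Rightarrow> complex) \<Rightarrow> real" where
  "ell1_norm a = (\<Sum>\<^sub>\<infinity>n. norm (a n))"

definition ell1_dist :: "(int \<Rightarrow> complex) \<Rightarrow> (int \<Rightarrow> complex) \<Rightarrow> real" where
  "ell1_dist a b = ell1_norm (\<lambda>n. a n - b n)"

definition pairing :: "linf \<Rightarrow> (int \<Rightarrow> complex) \<Rightarrow> complex" where
  "pairing x a = (\<Sum>\<^sub>\<infinity>n. x n * a n)"

lemma ell1_diff: "a \<in> ell1 \<Longrightarrow> b \<in> ell1 \<Longrightarrow> (\<lambda>n. a n - b n) \<in> ell1"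
  unfolding ell1_def mem_Collect_eq
  by (rule summable_on_comparison_test[where f = "\<lambda>n. norm (a n) + norm (b n)"])
    (auto intro: norm_triangle_ineq4 summable_on_add)

lemma Metric_space_ell1: "Metric_space ell1 ell1_dist"
proof
  fix a b show "0 \<le> ell1_dist a b"
    by (simp add: ell1_dist_def ell1_norm_def infsum_nonneg)
next
  fix a b show "ell1_dist a b = ell1_dist b a"
    by (simp add: ell1_dist_def ell1_norm_def norm_minus_commute)
next
  fix a b assume "a \<in> ell1" "b \<in> ell1"
  then have s: "(\<lambda>n. norm (a n - b n)) summable_on UNIV"
    using ell1_diff[of a b] by (simp add: ell1_def)
  show "ell1_dist a b = 0 \<longleftrightarrow> a = b"
  proof
    assume "ell1_dist a b = 0"
    then have "norm (a n - b n) = 0" for n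
      by (intro nonneg_infsum_le_0D[OF _ s]) (auto simp: ell1_dist_def ell1_norm_def)
    then show "a = b" by auto
  qed (simp add: ell1_dist_def ell1_norm_def)
next
  fix a b c assume abc: "a \<in> ell1" "b \<in> ell1" "c \<in> ell1"
  have s: "(\<lambda>n. norm (u n - v n)) summable_on UNIV" if "u \<in> ell1" "v \<in> ell1" for u v
    using ell1_diff[OF that] by (simp add: ell1_def)
  have "ell1_dist a c \<le> (\<Sum>\<^sub>\<infinity>n. norm (a n - b n) + norm (b n - c n))"
    unfolding ell1_dist_def ell1_norm_def
    by (intro infsum_mono summable_on_add s abc) (metis norm_triangle_ineq diff_add_cancel add_diff_eq)
  also have "\<dots> = ell1_dist a b + ell1_dist b c"
    unfolding ell1_dist_def ell1_norm_def by (intro infsum_add s abc)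
  finally show "ell1_dist a c \<le> ell1_dist a b + ell1_dist b c" .
qed

text \<open>
  Functionals on \<open>F\<close> are represented as functions that are \<^const>\<open>undefined\<close> outside \<open>F\<close>,
  so that equality of functions is equality of functionals on \<open>F\<close>.
\<close>

definition dual :: "linf set \<Rightarrow> (linf \<Rightarrow> complex) set" where
  "dual F = {\<phi> \<in> extensional F.
     (\<forall>x\<in>F. \<forall>y\<in>F. \<phi> (x + y) = \<phi> x + \<phi> y) \<and>
     (\<forall>c. \<forall>x\<in>F. \<phi> (cscale c x) = c * \<phi> x) \<and>
     (\<exists>C. \<forall>x\<in>F. norm (\<phi> x) \<le> C * norm x)}"

definition dual_norm :: "linf set \<Rightarrow> (linf \<Rightarrow> complex) \<Rightarrow> real" where
  "dual_norm F \<phi> = (SUP x\<in>{x\<in>F. norm x \<le> 1}. norm (\<phi> x))"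

text \<open>
  The guard is only there because \<^locale>\<open>Metric_space\<close> demands nonnegativity of the distance
  also outside the carrier, where the supremum need not exist.
\<close>

definition dual_dist :: "linf set \<Rightarrow> (linf \<Rightarrow> complex) \<Rightarrow> (linf \<Rightarrow> complex) \<Rightarrow> real" where
  "dual_dist F \<phi> \<psi> =
     (if \<phi> \<in> dual F \<and> \<psi> \<in> dual F then dual_norm F (\<lambda>x. \<phi> x - \<psi> x) else 0)"

definition iota :: "linf set \<Rightarrow> (int \<Rightarrow> complex) \<Rightarrow> (linf \<Rightarrow> complex)" where
  "iota F a = (\<lambda>x\<in>F. pairing x a)"

lemma Metric_space_dual:
  assumes F: "linf.subspace F"
  shows "Metric_space (dual F) (dual_dist F)"
proof -
  let ?B = "{x\<in>F. norm x \<le> 1}"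
  have 0: "0 \<in> ?B"
    using F by (simp add: linf.subspace_0)
  have bdd: "bdd_above ((\<lambda>x. norm (\<phi> x - \<psi> x)) ` ?B)"
    if "\<phi> \<in> dual F" "\<psi> \<in> dual F" for \<phi> \<psi>
  proof -
    from that(1) obtain C where C: "\<And>x. x \<in> F \<Longrightarrow> norm (\<phi> x) \<le> C * norm x"
      unfolding dual_def by blast
    from that(2) obtain D where D: "\<And>x. x \<in> F \<Longrightarrow> norm (\<psi> x) \<le> D * norm x"
      unfolding dual_def by blast
    have "norm (\<phi> x - \<psi> x) \<le> \<bar>C\<bar> + \<bar>D\<bar>" if "x \<in> ?B" for x
    proof -
      have "C * norm x \<le> \<bar>C\<bar> * 1" "D * norm x \<le> \<bar>D\<bar> * 1"
        using that by (intro mult_mono; simp)+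
      then show ?thesis
        using C[of x] D[of x] that norm_triangle_ineq4[of "\<phi> x" "\<psi> x"] by auto
    qed
    then show ?thesis by (auto simp: bdd_above_def)
  qed
  have up: "norm (\<phi> x - \<psi> x) \<le> dual_dist F \<phi> \<psi>"
    if "\<phi> \<in> dual F" "\<psi> \<in> dual F" "x \<in> ?B" for \<phi> \<psi> x
    using cSUP_upper[OF that(3) bdd[OF that(1,2)]] that by (simp add: dual_dist_def dual_norm_def)
  show ?thesis
  proof
    fix \<phi> \<psi> show "0 \<le> dual_dist F \<phi> \<psi>"
      using up[OF _ _ 0, of \<phi> \<psi>] norm_ge_zero order_trans
      by (cases "\<phi> \<in> dual F \<and> \<psi> \<in> dual F") (blast, auto simp: dual_dist_def)
  next
    fix \<phi> \<psi> show "dual_dist F \<phi> \<psi> = dual_dist F \<psi> \<phi>"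
      by (simp add: dual_dist_def dual_norm_def norm_minus_commute)
  next
    fix \<phi> \<psi> assume d: "\<phi> \<in> dual F" "\<psi> \<in> dual F"
    show "dual_dist F \<phi> \<psi> = 0 \<longleftrightarrow> \<phi> = \<psi>"
    proof
      assume z: "dual_dist F \<phi> \<psi> = 0"
      have "\<phi> x = \<psi> x" if x: "x \<in> F" for x
      proof -
        define c :: complex where "c = of_real (inverse (norm x + 1))"
        have pos: "norm x + 1 > 0" by (simp add: add_nonneg_pos)
        then have c: "c \<noteq> 0" "norm c = inverse (norm x + 1)"
          unfolding c_def norm_of_real of_real_eq_0_iff by auto
        have "norm c * norm x \<le> 1"
          unfolding c(2) using pos by (simp add: divide_simps)
        then have "cscale c x \<in> ?B"
          using x F by (simp add: linf.subspace_scale norm_cscale)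
        from up[OF d this] z have "\<phi> (cscale c x) = \<psi> (cscale c x)" by simp
        with d x c show ?thesis by (simp add: dual_def)
      qed
      with d show "\<phi> = \<psi>" by (auto simp: dual_def intro: extensionalityI)
    next
      assume "\<phi> = \<psi>"
      then show "dual_dist F \<phi> \<psi> = 0"
        using 0 by (auto simp: dual_dist_def dual_norm_def intro!: cSUP_const)
    qed
  next
    fix \<phi> \<psi> \<theta> assume d: "\<phi> \<in> dual F" "\<psi> \<in> dual F" "\<theta> \<in> dual F"
    have "norm (\<phi> x - \<theta> x) \<le> dual_dist F \<phi> \<psi> + dual_dist F \<psi> \<theta>" if "x \<in> ?B" for x
      using up[OF d(1,2) that] up[OF d(2,3) that] norm_triangle_ineq[of "\<phi> x - \<psi> x" "\<psi> x - \<theta> x"]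
      by simp
    then have "dual_norm F (\<lambda>x. \<phi> x - \<theta> x) \<le> dual_dist F \<phi> \<psi> + dual_dist F \<psi> \<theta>"
      unfolding dual_norm_def using 0 by (intro cSUP_least) auto
    with d show "dual_dist F \<phi> \<theta> \<le> dual_dist F \<phi> \<psi> + dual_dist F \<psi> \<theta>"
      by (simp add: dual_dist_def)
  qed
qed

definition concrete_predual :: "linf set \<Rightarrow> bool" where
  "concrete_predual F \<longleftrightarrow>
     linf.subspace F \<and> closed F \<and>
     (\<forall>a\<in>ell1. \<forall>b\<in>ell1. iota F (\<lambda>n. a n + b n) = (\<lambda>x\<in>F. iota F a x + iota F b x)) \<and>
     (\<forall>c. \<forall>a\<in>ell1. iota F (\<lambda>n. c * a n) = (\<lambda>x\<in>F. c * iota F a x)) \<and>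
     homeomorphic_map (Metric_space.mtopology ell1 ell1_dist)
       (Metric_space.mtopology (dual F) (dual_dist F)) (iota F)"

definition shift_by :: "int \<Rightarrow> linf \<Rightarrow> linf" where
  "shift_by m x = Bcontfun (\<lambda>n. x (n - m))"

lemma shift_by_apply: "shift_by m x n = x (n - m)"
proof -
  have "bounded (range (\<lambda>n. x (n - m)))"
    by (rule bounded_subset[OF bounded_apply_bcontfun[of x]]) auto
  then show ?thesis by (simp add: shift_by_def Bcontfun_inverse bcontfun_int_iff)
qed

abbreviation shift :: "linf \<Rightarrow> linf" where
  "shift \<equiv> shift_by 1"

text \<open>\<^term>\<open>shift_by m\<close> is the \<open>m\<close>-th iterate of the shift, for \<open>m\<close> of either sign:\<close>

lemma shift_by_0: "shift_by 0 = id"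
  by (auto intro!: bcontfun_eqI simp: shift_by_apply)

lemma shift_by_add: "shift_by (m + k) = shift_by m \<circ> shift_by k"
  by (auto intro!: bcontfun_eqI simp: shift_by_apply algebra_simps)

lemma shift_by_nat: "shift_by (int m) = shift ^^ m"
  by (induction m) (simp_all add: shift_by_0 shift_by_add)

lemma shift_by_minus_nat: "shift_by (- int m) = inv (shift ^^ m)"
proof (rule inv_unique_comp[symmetric])
  show "shift ^^ m \<circ> shift_by (- int m) = id" "shift_by (- int m) \<circ> shift ^^ m = id"
    by (simp_all flip: shift_by_nat shift_by_add add: shift_by_0)
qed

definition shift_invariant_predual :: "linf set \<Rightarrow> bool" where
  "shift_invariant_predual F \<longleftrightarrow> concrete_predual F \<and> shift ` F = F"

definition digit_count :: "int \<Rightarrow> nat" where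
  "digit_count n = card {i. bit n i}"

text \<open>Only used for \<^prop>\<open>norm lam > 1\<close>, where the sequence is indeed bounded.\<close>

definition x0 :: "complex \<Rightarrow> linf" where
  "x0 lam = Bcontfun (\<lambda>n. if n \<ge> 0 then lam powi (- int (digit_count n)) else 0)"

lemma x0_apply:
  assumes "norm lam > 1"
  shows "x0 lam n = (if n \<ge> 0 then lam powi (- int (digit_count n)) else 0)"
proof -
  have "norm (lam powi (- int k)) \<le> 1" for k
    using assms by (simp add: power_int_minus norm_inverse norm_power inverse_le_1_iff one_le_power)
  then have "(\<lambda>n. if n \<ge> 0 then lam powi (- int (digit_count n)) else 0) \<in> bcontfun"
    unfolding bcontfun_int_iff bounded_iff by (intro exI[of _ 1]) auto
  then show ?thesis by (simp add: x0_def Bcontfun_inverse)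
qed

definition F_space :: "complex \<Rightarrow> linf set" where
  "F_space lam = closure (linf.span (range (\<lambda>m. shift_by m (x0 lam))))"

text \<open>
  A set \<open>A\<close> belongs to the ultrafilter \<open>U\<close> iff \<^term>\<open>eventually (\<lambda>n. n \<in> A) U\<close>; the
  filter \<^term>\<open>bot\<close> is the improper one.
\<close>

definition ultrafilter :: "int filter \<Rightarrow> bool" where
  "ultrafilter U \<longleftrightarrow> U \<noteq> bot \<and> (\<forall>P. eventually P U \<or> eventually (\<lambda>n. \<not> P n) U)"

definition Zstar :: "int filter set" where
  "Zstar = {U. ultrafilter U \<and> (\<forall>n. U \<noteq> principal {n})}"

definition beta_eval :: "linf \<Rightarrow> int filter \<Rightarrow> complex" where
  "beta_eval x U = Lim U (apply_bcontfun x)"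

lemma tendsto_beta_eval:
  assumes U: "ultrafilter U"
  shows "(apply_bcontfun x \<longlongrightarrow> beta_eval x U) U"
proof -
  have nt: "U \<noteq> bot" using U by (simp add: ultrafilter_def)
  let ?G = "filtermap (apply_bcontfun x) U"
  have "compact (closure (range (apply_bcontfun x)))"
    by (simp add: compact_closure)
  moreover have "eventually (\<lambda>z. z \<in> closure (range (apply_bcontfun x))) ?G"
    by (auto simp: eventually_filtermap intro!: always_eventually closure_subset[THEN subsetD])
  moreover have "?G \<noteq> bot" using nt by (simp add: filtermap_bot_iff)
  ultimately obtain l where l: "inf (nhds l) ?G \<noteq> bot"
    unfolding compact_filter by blast
  have "(apply_bcontfun x \<longlongrightarrow> l) U"
  proof (rule topological_tendstoI)
    fix S assume S: "open S" "l \<in> S"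
    show "eventually (\<lambda>n. x n \<in> S) U"
    proof (rule ccontr)
      assume "\<not> ?thesis"
      then have "eventually (\<lambda>n. x n \<notin> S) U" using U unfolding ultrafilter_def by blast
      then have "eventually (\<lambda>z. z \<notin> S) ?G" by (simp add: eventually_filtermap)
      moreover have "eventually (\<lambda>z. z \<in> S) (nhds l)" using S by (auto simp: eventually_nhds)
      ultimately have "eventually (\<lambda>_. False) (inf (nhds l) ?G)"
        unfolding eventually_inf by blast
      with l show False by (simp add: trivial_limit_def)
    qed
  qed
  with nt show ?thesis by (simp add: beta_eval_def tendsto_Lim)
qed

definition X :: "nat \<Rightarrow> int \<Rightarrow> int filter set" where
  "X k t = {U \<in> Zstar. \<forall>m>0. eventually
     (\<lambda>j. j \<in> {(\<Sum>i=1..k. 2 ^ n i) + t | n :: nat \<Rightarrow> nat.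
                  m < n 1 \<and> strict_mono_on {1..k} n}) U}"

definition X_inf :: "int filter set" where
  "X_inf = Zstar - (\<Union>t. \<Union>k\<in>{1..}. X k t)"

end

theory Submission
  imports Defs
begin

text \<open>
  Put \<open>\<mu> = 1/\<lambda>\<close>. The multiplicativity \<open>x\<^sub>0(n) = x\<^sub>0(n mod 2\<^sup>j) x\<^sub>0(n div 2\<^sup>j)\<close> shows that
  \<open>y\<^sub>j = y\<^sub>j\<^sub>+\<^sub>1 + \<mu> \<sigma>\<^sup>m(y\<^sub>j\<^sub>+\<^sub>1)\<close> with \<open>m = 2\<^sup>j\<close>, where \<open>y\<^sub>j\<close> is \<open>x\<^sub>0\<close> spread out over the multiples of
  \<open>2\<^sup>j\<close>; a geometric series then puts every \<open>y\<^sub>j\<close> into \<open>F\<close>. Translates of \<open>y\<^sub>j\<close> by a window of \<open>2\<^sup>j\<close>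
  consecutive integers have disjoint supports, so \<open>F\<close> interpolates arbitrary values on finite sets
  without increasing the norm, and \<open>\<iota>\<^sub>F\<close> is even isometric.

  For a functional \<open>\<phi>\<close> on \<open>F\<close> the limits \<open>a(t) = lim \<phi>(\<sigma>\<^sup>t y\<^sub>j)\<close> exist, because the
  differences \<open>y\<^sub>j - y\<^sub>j\<^sub>+\<^sub>1\<close> are disjointly supported, and they form an element of \<open>\<ell>\<^sub>1\<close>. The functional
  \<open>\<psi> = \<phi> - \<iota>\<^sub>F(a)\<close> satisfies \<open>\<psi>(\<sigma>\<^sup>t y\<^sub>j) \<longlonglongrightarrow> 0\<close>. Rewriting a combination of translates of \<open>y\<^sub>j\<close> at
  a much finer level and dropping the original window costs little under \<open>\<psi>\<close> and multiplies the
  norm by \<open>\<bar>\<mu>\<bar>\<close>; iterating gives \<open>\<psi> = 0\<close>.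

  Conversely, if \<open>x\<close> satisfies the limit conditions, then \<open>\<bar>x\<bar>\<close> exceeds \<open>\<bar>\<mu>\<bar>\<parallel>x\<parallel> + \<epsilon>\<close> only on a finite set.
  Interpolating \<open>x\<close> there by translates of \<open>y\<^sub>j\<close> with \<open>j\<close> large gives \<open>w\<close> in \<open>F\<close> with
  \<open>\<parallel>x - w\<parallel> \<le> \<bar>\<mu>\<bar>\<parallel>x\<parallel> + 2\<epsilon>\<close>, and iterating puts \<open>x\<close> into \<open>F\<close>.
\<close>

section \<open>Binary digits\<close>

lemma finite_bits:
  fixes n :: int
  assumes "0 \<le> n"
  shows "finite {i. bit n i}"
proof (rule finite_subset)
  have "take_bit (nat n) n = n"
    using assms of_nat_less_two_power[of "nat n", where 'a = int] by (simp add: take_bit_int_eq_self_iff)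
  then show "{i. bit n i} \<subseteq> {..<nat n}"
    by (metis bit_take_bit_iff lessThan_iff mem_Collect_eq subsetI)
qed simp

lemma digit_count_0 [simp]: "digit_count 0 = 0"
  by (simp add: digit_count_def)

lemma digit_count_pos:
  assumes "0 < n"
  shows "0 < digit_count n"
proof -
  have "{i. bit n i} \<noteq> {}"
    using assms by (metis Collect_empty_eq bit_eq_iff bit_0_eq bot_apply bot_bool_def less_irrefl)
  then show ?thesis
    using finite_bits[of n] assms by (simp add: digit_count_def card_gt_0_iff)
qed

text \<open>The positions below \<open>j\<close> and those from \<open>j\<close> on partition the
  set of ones. This additivity is the source of the multiplicativity of \<open>x0\<close>.\<close>

lemma digit_count_split:
  assumes "0 \<le> n"
  shows "digit_count n = digit_count (n mod 2 ^ j) + digit_count (n div 2 ^ j)"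
proof -
  let ?low = "{i. bit n i \<and> i < j}" and ?high = "{i. bit n i \<and> j \<le> i}"
  have "{i. bit (n mod 2 ^ j) i} = ?low"
    by (auto simp: bit_take_bit_iff simp flip: take_bit_eq_mod)
  moreover have "bij_betw (\<lambda>i. j + i) {i. bit (n div 2 ^ j) i} ?high"
    by (rule bij_betw_byWitness[where f' = "\<lambda>i. i - j"])
      (auto simp: bit_drop_bit_eq simp flip: drop_bit_eq_div)
  moreover have "{i. bit n i} = ?low \<union> ?high"
    by auto
  moreover have "card (?low \<union> ?high) = card ?low + card ?high"
    using finite_bits[OF assms] by (intro card_Un_disjoint) auto
  ultimately show ?thesis
    unfolding digit_count_def by (metis bij_betw_same_card)
qed

lemma digit_count_mult_power:
  assumes "0 \<le> n"
  shows "digit_count (2 ^ j * n) = digit_count n"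
  using digit_count_split[of "2 ^ j * n" j] assms by simp

lemma digit_count_mask: "digit_count (2 ^ r - 1) = r"
proof -
  have "{i. bit (mask r :: int) i} = {..<r}"
    by (auto simp: bit_mask_iff)
  then show ?thesis
    by (simp add: digit_count_def mask_eq_exp_minus_1)
qed

lemma bit_sum_power_iff:
  assumes "finite A"
  shows "bit (\<Sum>a\<in>A. 2 ^ a :: int) i \<longleftrightarrow> i \<in> A"
  using assms
proof (induction A arbitrary: i)
  case (insert a A)
  \<comment> \<open>Distinct exponents produce no carries, so the addition is a bitwise
    disjunction.\<close>
  have "2 ^ a + (\<Sum>a\<in>A. 2 ^ a) = or (2 ^ a) (\<Sum>a\<in>A. 2 ^ a :: int)"
    using insert by (intro disjunctive_add_eq_or bit_eqI) (auto simp: bit_and_iff bit_exp_iff)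
  with insert show ?case
    by (auto simp: bit_or_iff bit_exp_iff)
qed simp

lemma bit_sum_strict_mono_iff:
  fixes n :: "nat \<Rightarrow> nat"
  assumes "strict_mono_on {1..k} n"
  shows "bit (\<Sum>i=1..k. 2 ^ n i :: int) i \<longleftrightarrow> i \<in> n ` {1..k}"
proof -
  have "(\<Sum>i=1..k. 2 ^ n i :: int) = (\<Sum>a\<in>n ` {1..k}. 2 ^ a)"
    using assms strict_mono_on_imp_inj_on by (subst sum.reindex) (auto simp: o_def)
  then show ?thesis
    by (simp add: bit_sum_power_iff)
qed

lemma ex_strict_mono_enum:
  assumes "finite (A :: nat set)" "card A = k"
  shows "\<exists>n. strict_mono_on {1..k} n \<and> n ` {1..k} = A"
proof (intro exI conjI)
  \<comment> \<open>Lists are indexed from 0, the exponents in \<open>X\<close> from 1.\<close>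
  let ?n = "\<lambda>i. sorted_list_of_set A ! (i - 1)"
  have len: "length (sorted_list_of_set A) = k"
    using assms by simp
  show "strict_mono_on {1..k} ?n"
    using len sorted_wrt_nth_less[OF strict_sorted_list_of_set[of A]]
    by (auto simp: strict_mono_on_def)
  have "?n ` {1..k} = (!) (sorted_list_of_set A) ` {..<k}"
  proof -
    have "(\<lambda>i. i - 1) ` {1..k} = {..<k}"
      by (force simp: image_iff intro!: bexI[where x = "Suc _"])
    then show ?thesis
      using image_image[of "(!) (sorted_list_of_set A)" "\<lambda>i. i - 1" "{1..k}"] by simp
  qed
  then show "?n ` {1..k} = A"
    using assms len nth_image[of k "sorted_list_of_set A"] by (simp add: lessThan_atLeast0)
qed

text \<open>The exponents \<open>n i\<close> are the positions of the ones of \<open>j - t\<close>.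
  The smallest is \<open>n 1\<close>, so \<open>m < n 1\<close> turns into divisibility by
  \<open>2 ^ Suc m\<close>.\<close>

lemma digit_sums_eq:
  assumes "1 \<le> k"
  shows "{(\<Sum>i=1..k. 2 ^ n i) + t | n :: nat \<Rightarrow> nat. m < n 1 \<and> strict_mono_on {1..k} n}
    = {j. t \<le> j \<and> 2 ^ Suc m dvd j - t \<and> digit_count (j - t) = k}" (is "?L = ?R")
proof (intro equalityI subsetI)
  fix j assume "j \<in> ?L"
  then obtain n :: "nat \<Rightarrow> nat" where n: "m < n 1" "strict_mono_on {1..k} n"
    and j: "j - t = (\<Sum>i=1..k. 2 ^ n i)"
    by auto
  have "Suc m \<le> n i" if "i \<in> {1..k}" for i
    using n that assms by (cases "i = 1") (auto dest: strict_mono_onD[of _ _ 1 i])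
  then have "2 ^ Suc m dvd (\<Sum>i=1..k. 2 ^ n i :: int)"
    by (intro dvd_sum le_imp_power_dvd) auto
  moreover have "digit_count (j - t) = card (n ` {1..k})"
    unfolding digit_count_def j bit_sum_strict_mono_iff[OF n(2)] by simp
  moreover have "card (n ` {1..k}) = k"
    using strict_mono_on_imp_inj_on[OF n(2)] by (simp add: card_image)
  moreover have "0 \<le> j - t"
    unfolding j by (intro sum_nonneg) auto
  ultimately show "j \<in> ?R"
    using j by simp
next
  fix j assume j: "j \<in> ?R"
  let ?A = "{i. bit (j - t) i}"
  have fin: "finite ?A" and card: "card ?A = k"
    using j finite_bits[of "j - t"] by (auto simp: digit_count_def)
  have low: "m < i" if "bit (j - t) i" for i
  proof (rule ccontr)
    assume "\<not> m < i"
    moreover have "take_bit (Suc m) (j - t) = 0"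
      using j by (auto simp: take_bit_eq_mod mod_eq_0_iff_dvd simp del: power_Suc)
    then have "\<not> bit (take_bit (Suc m) (j - t)) i"
      by simp
    ultimately show False
      using that by (simp add: bit_take_bit_iff)
  qed
  obtain n where n: "strict_mono_on {1..k} n" "n ` {1..k} = ?A"
    using ex_strict_mono_enum[OF fin card] by blast
  have "j - t = (\<Sum>i=1..k. 2 ^ n i)"
    by (rule bit_eqI) (metis bit_sum_strict_mono_iff[OF n(1)] n(2) mem_Collect_eq)
  moreover have "m < n 1"
    using n(2) assms low by (metis (mono_tags, lifting) atLeastAtMost_iff image_eqI le_refl mem_Collect_eq)
  ultimately show "j \<in> ?L"
    using n(1) by (auto simp: algebra_simps intro!: exI[of _ n])
qed

section \<open>Ultrafilters on the integers\<close>

text \<open>The conditions get stronger as the exponent grows, so the restriction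
  \<open>m > 0\<close> and the offset \<open>Suc m\<close> can both be dropped.\<close>

lemma X_iff:
  assumes "1 \<le> k"
  shows "U \<in> X k t \<longleftrightarrow> U \<in> Zstar \<and>
    (\<forall>m. eventually (\<lambda>j. t \<le> j \<and> 2 ^ m dvd j - t \<and> digit_count (j - t) = k) U)"
proof -
  have "eventually (\<lambda>j. t \<le> j \<and> 2 ^ m dvd j - t \<and> digit_count (j - t) = k) U"
    if "\<forall>m>0. eventually (\<lambda>j. t \<le> j \<and> 2 ^ Suc m dvd j - t \<and> digit_count (j - t) = k) U" for m
    using that[rule_format, of "Suc m"]
    by (auto elim!: eventually_mono intro: dvd_trans[OF le_imp_power_dvd, rotated] simp del: power_Suc)
  then show ?thesis
    unfolding X_def mem_Collect_eq digit_sums_eq[OF assms] by blast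
qed

text \<open>Ultrafilters are the minimal proper filters, and Zorn's lemma supplies one below
  \<open>F\<close>.\<close>

lemma ultrafilter_exists:
  fixes F :: "int filter"
  assumes "F \<noteq> bot"
  obtains U where "ultrafilter U" "U \<le> F"
proof -
  let ?A = "{G. G \<noteq> bot \<and> G \<le> F}"
  have "\<exists>U\<in>?A. \<forall>G\<in>?A. G \<le> U \<longrightarrow> G = U"
  proof (rule predicate_Zorn)
    \<comment> \<open>The order is reversed: a maximal element for it is a minimal proper
      filter.\<close>
    show "partial_order_on ?A (relation_of (\<lambda>x y. y \<le> x) ?A)"
      by (rule partial_order_on_relation_ofI) auto
  next
    fix C assume C: "C \<in> Chains (relation_of (\<lambda>x y. y \<le> x) ?A)"
    then have sub: "C \<subseteq> ?A"
      by (auto simp: Chains_def relation_of_def)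
    have chain: "x \<le> y \<or> y \<le> x" if "x \<in> C" "y \<in> C" for x y
      using C that by (auto simp: Chains_def relation_of_def)
    show "\<exists>u\<in>?A. \<forall>a\<in>C. u \<le> a"
    proof (cases "C = {}")
      case True
      with assms show ?thesis by auto
    next
      case False
      have "Inf C \<noteq> bot"
      proof
        assume "Inf C = bot"
        then have "eventually (\<lambda>_. False) (Inf C)"
          by (simp add: trivial_limit_def)
        \<comment> \<open>A chain is directed downwards, so an event of \<open>Inf C\<close> is
          already an event of a single member.\<close>
        moreover have "\<exists>x\<in>C. x \<le> inf G H" if "G \<in> C" "H \<in> C" for G H
          using chain[OF that] that by (metis inf.absorb2 inf.absorb1 order_refl)
        ultimately obtain G where "G \<in> C" "eventually (\<lambda>_. False) G"
          using False by (subst (asm) eventually_Inf_base) auto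
        with sub show False by (auto simp: trivial_limit_def)
      qed
      moreover have "Inf C \<le> F"
        using False sub by (metis (no_types, lifting) Inf_lower2 equals0I mem_Collect_eq subset_iff)
      ultimately show ?thesis
        by (auto intro!: bexI[of _ "Inf C"] Inf_lower)
    qed
  qed
  then obtain U where U: "U \<noteq> bot" "U \<le> F" and max: "\<And>G. G \<noteq> bot \<Longrightarrow> G \<le> U \<Longrightarrow> G = U"
    by (metis (mono_tags, lifting) mem_Collect_eq order_trans)
  have "eventually P U \<or> eventually (\<lambda>n. \<not> P n) U" for P
  proof (rule ccontr)
    assume *: "\<not> ?thesis"
    have "inf U (principal {n. P n}) \<noteq> bot"
      using * by (auto simp: trivial_limit_def eventually_inf_principal)
    then have "inf U (principal {n. P n}) = U"
      by (rule max) simp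
    moreover have "eventually P (inf U (principal {n. P n}))"
      by (simp add: eventually_inf_principal)
    ultimately show False using * by simp
  qed
  with U that show thesis
    by (auto simp: ultrafilter_def)
qed

lemma ultrafilter_in_infinite_set:
  fixes A :: "int set"
  assumes "infinite A"
  obtains U where "U \<in> Zstar" "eventually (\<lambda>n. n \<in> A) U"
proof -
  have "inf cofinite (principal A) \<noteq> bot"
    using assms by (simp add: trivial_limit_def eventually_inf_principal eventually_cofinite)
  then obtain U where U: "ultrafilter U" "U \<le> inf cofinite (principal A)"
    by (rule ultrafilter_exists)
  have "U \<noteq> principal {n}" for n
  proof
    assume n: "U = principal {n}"
    have "eventually (\<lambda>k. k \<noteq> n) U"
      using U(2) by (intro filter_leD[of U cofinite]) (auto simp: eventually_cofinite)
    then show False by (simp add: n eventually_principal)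
  qed
  moreover have "eventually (\<lambda>n. n \<in> A) U"
    using U(2) by (intro filter_leD[of U "principal A"]) (auto simp: eventually_principal)
  ultimately show thesis
    using that[of U] U(1) by (simp add: Zstar_def)
qed

lemma ultrafilter_eventually_not:
  "ultrafilter U \<Longrightarrow> \<not> eventually P U \<Longrightarrow> eventually (\<lambda>n. \<not> P n) U"
  by (auto simp: ultrafilter_def)

lemma ultrafilter_eventually_finite_ex:
  assumes U: "ultrafilter U" and "finite D" and ev: "eventually (\<lambda>n. \<exists>d\<in>D. P d n) U"
  obtains d where "d \<in> D" "eventually (P d) U"
proof (rule ccontr)
  assume "\<not> thesis"
  then have "eventually (\<lambda>n. \<forall>d\<in>D. \<not> P d n) U"
    using that \<open>finite D\<close> U by (intro eventually_ball_finite) (auto intro: ultrafilter_eventually_not)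
  with ev have "eventually (\<lambda>_. False) U"
    by eventually_elim blast
  with U show False by (simp add: ultrafilter_def trivial_limit_def)
qed

lemma ultrafilter_eq_principal:
  assumes "ultrafilter U" "eventually (\<lambda>n. n = t) U"
  shows "U = principal {t}"
proof -
  have "eventually P U \<longleftrightarrow> P t" for P
  proof
    assume "eventually P U"
    with assms(2) have "eventually (\<lambda>_. P t) U"
      by eventually_elim simp
    with assms(1) show "P t"
      by (simp add: ultrafilter_def)
  next
    assume "P t"
    with assms(2) show "eventually P U"
      by (auto elim: eventually_mono)
  qed
  then show ?thesis
    by (simp add: filter_eq_iff eventually_principal)
qed

lemma beta_eval_eqI:
  assumes "ultrafilter U" "(apply_bcontfun x \<longlongrightarrow> l) U"
  shows "beta_eval x U = l"
  using assms unfolding beta_eval_def ultrafilter_def by (auto intro: tendsto_Lim)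

lemma norm_beta_eval_le:
  assumes "ultrafilter U"
  shows "norm (beta_eval x U) \<le> norm x"
  using assms tendsto_beta_eval[OF assms, of x]
  by (intro Lim_norm_ubound[of U x]) (auto simp: ultrafilter_def norm_bounded)

lemma beta_eval_add:
  assumes "ultrafilter U"
  shows "beta_eval (x + y) U = beta_eval x U + beta_eval y U"
  using tendsto_add[OF tendsto_beta_eval[OF assms] tendsto_beta_eval[OF assms], of x y]
  by (intro beta_eval_eqI[OF assms]) (simp add: plus_bcontfun.rep_eq)

lemma beta_eval_diff:
  assumes "ultrafilter U"
  shows "beta_eval (x - y) U = beta_eval x U - beta_eval y U"
  using beta_eval_add[OF assms, of "x - y" y] by simp

lemma beta_eval_cscale:
  assumes "ultrafilter U"
  shows "beta_eval (cscale c x) U = c * beta_eval x U"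
  using tendsto_mult_left[OF tendsto_beta_eval[OF assms], of c x]
  by (intro beta_eval_eqI[OF assms]) (simp add: cscale_apply[abs_def])

lemma linf_subspace_beta_eval_eq:
  assumes "ultrafilter U"
  shows "linf.subspace {x. beta_eval x U = c * x t}"
  using beta_eval_cscale[OF assms, of 0 0]
  by (intro linf.subspaceI)
    (auto simp: beta_eval_add[OF assms] beta_eval_cscale[OF assms] cscale_apply algebra_simps)

lemma closed_beta_eval_eq:
  assumes "ultrafilter U"
  shows "closed {x :: linf. beta_eval x U = c * x t}"
proof -
  have "1-lipschitz_on UNIV (\<lambda>x. beta_eval x U)"
    using norm_beta_eval_le[OF assms]
    by (intro lipschitz_onI) (auto simp: dist_norm simp flip: beta_eval_diff[OF assms])
  moreover have "1-lipschitz_on UNIV (\<lambda>x :: linf. x t)"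
    by (intro lipschitz_onI) (auto simp: dist_norm, metis minus_bcontfun.rep_eq norm_bounded)
  ultimately show ?thesis
    by (intro closed_Collect_eq continuous_on_mult continuous_on_const) (auto intro: lipschitz_on_continuous_on)
qed

lemma Zstar_imp_ultrafilter: "U \<in> Zstar \<Longrightarrow> ultrafilter U"
  by (simp add: Zstar_def)

lemma X_subset_Zstar: "X k t \<subseteq> Zstar" and X_inf_subset_Zstar: "X_inf \<subseteq> Zstar"
  by (auto simp: X_def X_inf_def)

section \<open>Bounded sequences, pairings and dual spaces\<close>

lemma apply_Bcontfun:
  fixes f :: "int \<Rightarrow> complex"
  assumes "\<And>n. norm (f n) \<le> B"
  shows "apply_bcontfun (Bcontfun f) n = f n"
proof -
  have "f \<in> bcontfun"
    unfolding bcontfun_int_iff bounded_iff using assms by blast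
  then show ?thesis by (simp add: Bcontfun_inverse)
qed

lemma linf_sum_apply: "apply_bcontfun (sum f A) n = (\<Sum>i\<in>A. apply_bcontfun (f i) n)"
  for f :: "'a \<Rightarrow> linf"
  by (induction A rule: infinite_finite_induct) auto

lemma continuous_on_cscale: "continuous_on S (cscale c)"
proof (rule continuous_on_subset[OF _ subset_UNIV], rule lipschitz_on_continuous_on)
  show "(norm c)-lipschitz_on UNIV (cscale c)"
    by (rule lipschitz_onI) (auto simp: dist_norm norm_cscale simp flip: linf.scale_right_diff_distrib)
qed

lemma norm_shift_by: "norm (shift_by m x) = norm x"
proof (rule antisym)
  show "norm (shift_by m x) \<le> norm x"
    by (rule norm_bound) (simp add: shift_by_apply norm_bounded)
  have "norm (x n) \<le> norm (shift_by m x)" for n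
    using norm_bounded[of "shift_by m x" "n + m"] by (simp add: shift_by_apply)
  then show "norm x \<le> norm (shift_by m x)"
    by (rule norm_bound)
qed

lemma continuous_on_shift_by: "continuous_on S (shift_by m)"
proof (rule continuous_on_subset[OF _ subset_UNIV], rule lipschitz_on_continuous_on)
  have "shift_by m x - shift_by m y = shift_by m (x - y)" for x y
    by (rule bcontfun_eqI) (simp add: shift_by_apply)
  then show "1-lipschitz_on UNIV (shift_by m)"
    by (intro lipschitz_onI) (auto simp: dist_norm norm_shift_by)
qed

lemma linf_subspace_closure:
  assumes "linf.subspace S"
  shows "linf.subspace (closure S)"
proof (rule linf.subspaceI)
  show "0 \<in> closure S"
    using assms by (meson closure_subset linf.subspace_0 subsetD)
next
  fix x y assume "x \<in> closure S" "y \<in> closure S"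
  then obtain f g where "\<forall>n. f n \<in> S" "f \<longlonglongrightarrow> x" "\<forall>n. g n \<in> S" "g \<longlonglongrightarrow> y"
    unfolding closure_sequential by blast
  then show "x + y \<in> closure S"
    unfolding closure_sequential using assms
    by (intro exI[of _ "\<lambda>n. f n + g n"]) (auto intro: tendsto_add linf.subspace_add)
next
  fix c x assume x: "x \<in> closure S"
  have "cscale c ` S \<subseteq> closure S"
    using linf.subspace_scale[OF assms] closure_subset by blast
  then have "cscale c ` closure S \<subseteq> closure S"
    by (intro image_closure_subset continuous_on_cscale) auto
  with x show "cscale c x \<in> closure S" by blast
qed

text \<open>The left end \<open>m\<close> does not depend on \<open>j\<close>, so the mesh can be
  refined later while the window keeps its base point.\<close>

lemma finite_int_subset_window:
  assumes "finite (A :: int set)"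
  shows "\<exists>m j0. \<forall>j\<ge>j0. A \<subseteq> {m..<m + 2 ^ j}"
proof -
  have "A \<subseteq> {Min (insert 0 A)..<Max (insert 0 A) + 1}"
    using assms by (auto simp: zless_add1_eq le_less[symmetric])
  then obtain a b where ab: "A \<subseteq> {a..<b}"
    by blast
  have "b \<le> a + 2 ^ j" if "nat (b - a) \<le> j" for j
  proof -
    have "b - a \<le> int (nat (b - a))" by simp
    also have "\<dots> < 2 ^ nat (b - a)" by (rule of_nat_less_two_power)
    also have "\<dots> \<le> 2 ^ j" using that by (intro power_increasing) auto
    finally show ?thesis by simp
  qed
  with ab show ?thesis
    by (intro exI[of _ a] exI[of _ "nat (b - a)"]) force
qed

lemma cnj_sgn_mult: "cnj (sgn z) * z = of_real (norm z)"
  by (cases "z = 0")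
    (simp_all add: sgn_eq power2_eq_square divide_simps mult.commute[of "cnj z"] complex_norm_square[symmetric]
      del: of_real_power)

lemma norm_cnj_sgn_le: "norm (cnj (sgn z)) \<le> 1"
  by (simp add: norm_sgn)

lemma ell1_abs_summable:
  assumes "a \<in> ell1"
  shows "(\<lambda>n. norm (a n)) summable_on S"
  using assms summable_on_subset_banach[of "\<lambda>n. norm (a n)" UNIV S] by (simp add: ell1_def)

lemma pairing_abs_summable:
  fixes x :: linf
  assumes "a \<in> ell1"
  shows "(\<lambda>n. norm (x n * a n)) summable_on S"
proof (rule Infinite_Sum.abs_summable_on_comparison_test')
  show "(\<lambda>n. norm x * norm (a n)) summable_on S"
    by (intro summable_on_cmult_right ell1_abs_summable assms)
qed (simp add: norm_mult mult_right_mono norm_bounded)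

lemma pairing_summable:
  fixes x :: linf
  assumes "a \<in> ell1"
  shows "(\<lambda>n. x n * a n) summable_on S"
  using pairing_abs_summable[OF assms] by (rule abs_summable_summable)

lemma norm_infsum_pairing_le:
  fixes x :: linf
  assumes "a \<in> ell1"
  shows "norm (\<Sum>\<^sub>\<infinity>n\<in>S. x n * a n) \<le> norm x * (\<Sum>\<^sub>\<infinity>n\<in>S. norm (a n))"
proof -
  have "norm (\<Sum>\<^sub>\<infinity>n\<in>S. x n * a n) \<le> (\<Sum>\<^sub>\<infinity>n\<in>S. norm (x n * a n))"
    by (intro norm_infsum_bound pairing_abs_summable assms)
  also have "\<dots> \<le> (\<Sum>\<^sub>\<infinity>n\<in>S. norm x * norm (a n))"
    by (intro infsum_mono pairing_abs_summable summable_on_cmult_right ell1_abs_summable assms)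
      (simp add: norm_mult mult_right_mono norm_bounded)
  also have "\<dots> = norm x * (\<Sum>\<^sub>\<infinity>n\<in>S. norm (a n))"
    by (intro infsum_cmult_right ell1_abs_summable assms)
  finally show ?thesis .
qed

lemma norm_pairing_le: "a \<in> ell1 \<Longrightarrow> norm (pairing x a) \<le> ell1_norm a * norm x"
  using norm_infsum_pairing_le[of a x UNIV] by (simp add: pairing_def ell1_norm_def mult.commute)

text \<open>One finite set carries almost all the mass of \<open>a\<close>; the same set then works
  for every \<open>x\<close>, with an error relative to \<open>norm x\<close>.\<close>

lemma pairing_approx:
  assumes a: "a \<in> ell1" and "0 < e"
  obtains A where "finite A" "ell1_norm a \<le> (\<Sum>n\<in>A. norm (a n)) + e"
    "\<And>x :: linf. norm (pairing x a - (\<Sum>n\<in>A. x n * a n)) \<le> e * norm x"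
proof -
  obtain A where A: "finite A" "dist (\<Sum>n\<in>A. norm (a n)) (ell1_norm a) \<le> e"
    using infsum_finite_approximation[OF ell1_abs_summable[OF a, of UNIV] \<open>0 < e\<close>]
    unfolding ell1_norm_def by blast
  have split: "infsum f UNIV = sum f A + infsum f (- A)"
    if "\<And>S. f summable_on S" for f :: "int \<Rightarrow> 'b :: banach"
    using infsum_Un_disjoint[OF that[of A] that[of "- A"]] A(1) by simp
  have tail: "(\<Sum>\<^sub>\<infinity>n\<in>- A. norm (a n)) \<le> e"
    using split[OF ell1_abs_summable[OF a]] A(2) by (simp add: ell1_norm_def dist_real_def)
  have "norm (pairing x a - (\<Sum>n\<in>A. x n * a n)) \<le> e * norm x" for x :: linf
  proof -
    have "pairing x a - (\<Sum>n\<in>A. x n * a n) = (\<Sum>\<^sub>\<infinity>n\<in>- A. x n * a n)"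
      using split[OF pairing_summable[OF a]] by (simp add: pairing_def)
    also have "norm \<dots> \<le> norm x * (\<Sum>\<^sub>\<infinity>n\<in>- A. norm (a n))"
      by (rule norm_infsum_pairing_le[OF a])
    also have "\<dots> \<le> norm x * e"
      using tail by (intro mult_left_mono) auto
    finally show ?thesis by (simp add: mult.commute)
  qed
  then show thesis
    using A by (intro that[of A]) (auto simp: dist_real_def)
qed

lemma pairing_add_left: "a \<in> ell1 \<Longrightarrow> pairing (x + y) a = pairing x a + pairing y a"
  unfolding pairing_def plus_bcontfun.rep_eq distrib_right by (intro infsum_add pairing_summable)

lemma pairing_cscale_left: "a \<in> ell1 \<Longrightarrow> pairing (cscale c x) a = c * pairing x a"
  unfolding pairing_def cscale_apply mult.assoc by (intro infsum_cmult_right pairing_summable)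

lemma pairing_add_right:
  "a \<in> ell1 \<Longrightarrow> b \<in> ell1 \<Longrightarrow> pairing x (\<lambda>n. a n + b n) = pairing x a + pairing x b"
  unfolding pairing_def distrib_left by (intro infsum_add pairing_summable)

lemma pairing_diff_right:
  "a \<in> ell1 \<Longrightarrow> b \<in> ell1 \<Longrightarrow> pairing x (\<lambda>n. a n - b n) = pairing x a - pairing x b"
  using pairing_add_right[of "\<lambda>n. a n - b n" b x] by (simp add: ell1_diff)

lemma pairing_scale_right: "a \<in> ell1 \<Longrightarrow> pairing x (\<lambda>n. c * a n) = c * pairing x a"
  unfolding pairing_def mult.left_commute[of _ c] by (intro infsum_cmult_right pairing_summable)

lemma iota_in_dual:
  assumes "linf.subspace S" "a \<in> ell1"
  shows "iota S a \<in> dual S"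
  unfolding dual_def iota_def mem_Collect_eq using assms
  by (intro conjI exI[of _ "ell1_norm a"])
    (auto simp: linf.subspace_add linf.subspace_scale pairing_add_left pairing_cscale_left norm_pairing_le)

lemma dual_boundE:
  assumes "\<phi> \<in> dual S"
  obtains C where "0 \<le> C" "\<And>x. x \<in> S \<Longrightarrow> norm (\<phi> x) \<le> C * norm x"
proof -
  obtain C where C: "\<forall>x\<in>S. norm (\<phi> x) \<le> C * norm x"
    using assms by (auto simp: dual_def)
  have "norm (\<phi> x) \<le> \<bar>C\<bar> * norm x" if "x \<in> S" for x
    using C that by (meson abs_ge_self mult_right_mono norm_ge_zero order_trans)
  then show thesis
    by (intro that[of "\<bar>C\<bar>"]) auto
qed

lemma dual_diff:
  assumes S: "linf.subspace S" and "\<phi> \<in> dual S" "\<psi> \<in> dual S"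
  shows "(\<lambda>x\<in>S. \<phi> x - \<psi> x) \<in> dual S"
proof -
  obtain C D where C: "\<And>x. x \<in> S \<Longrightarrow> norm (\<phi> x) \<le> C * norm x"
    and D: "\<And>x. x \<in> S \<Longrightarrow> norm (\<psi> x) \<le> D * norm x"
    using assms(2,3) by (meson dual_boundE)
  have "norm (\<phi> x - \<psi> x) \<le> (C + D) * norm x" if "x \<in> S" for x
    using C[OF that] D[OF that] norm_triangle_ineq4[of "\<phi> x" "\<psi> x"] by (simp add: distrib_right)
  then show ?thesis
    using assms unfolding dual_def
    by (auto simp: linf.subspace_add linf.subspace_scale algebra_simps intro!: exI[of _ "C + D"])
qed

lemma dual_lin_sum:
  assumes S: "linf.subspace S" and \<phi>: "\<phi> \<in> dual S" and f: "\<And>i. i \<in> I \<Longrightarrow> f i \<in> S"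
  shows "\<phi> (\<Sum>i\<in>I. cscale (c i) (f i)) = (\<Sum>i\<in>I. c i * \<phi> (f i))"
  using f
proof (induction I rule: infinite_finite_induct)
  case (insert i I)
  then have "cscale (c i) (f i) \<in> S" "(\<Sum>i\<in>I. cscale (c i) (f i)) \<in> S"
    using S by (auto intro!: linf.subspace_scale linf.subspace_sum)
  with insert \<phi> show ?case
    by (simp add: dual_def)
\<comment> \<open>For empty and infinite index sets both sums are 0, and \<open>\<phi> 0 = 0\<close>
  comes from scaling by 0.\<close>
qed (use \<phi> linf.subspace_0[OF S] linf.scale_zero_left in \<open>auto simp: dual_def; metis mult_zero_left\<close>)+

section \<open>The space spanned by the shifts of the binary weight\<close>

locale binary_weight =
  fixes lam :: complex
  assumes lam: "1 < norm lam"
begin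

abbreviation mu :: complex where "mu \<equiv> inverse lam"

abbreviation F :: "linf set" where "F \<equiv> F_space lam"

lemma norm_mu: "norm mu < 1"
  using lam by (simp add: norm_inverse inverse_less_1_iff)

lemma x0_eq: "x0 lam n = (if 0 \<le> n then mu ^ digit_count n else 0)"
  using x0_apply[OF lam] by (simp add: power_int_minus power_inverse)

lemma x0_0 [simp]: "x0 lam 0 = 1"
  by (simp add: x0_eq)

text \<open>For negative \<open>n\<close> both sides vanish, because the quotient is then
  negative.\<close>

lemma x0_split: "x0 lam n = x0 lam (n mod 2 ^ j) * x0 lam (n div 2 ^ j)"
  using digit_count_split[of n j] by (auto simp: x0_eq power_add pos_imp_zdiv_nonneg_iff)

lemma norm_x0_le: "norm (x0 lam n) \<le> 1"
  using norm_mu by (auto simp: x0_eq norm_power intro!: power_le_one simp del: norm_inverse)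

text \<open>A nonzero argument has at least one binary one or is negative. This is the contraction
  factor of the vanishing argument for functionals.\<close>

lemma norm_x0_le_mu:
  assumes "n \<noteq> 0"
  shows "norm (x0 lam n) \<le> norm mu"
proof (cases "0 \<le> n")
  case True
  then have "norm mu ^ digit_count n \<le> norm mu ^ 1"
    using assms digit_count_pos[of n] norm_mu by (intro power_decreasing) auto
  with True show ?thesis
    by (simp add: x0_eq norm_power)
qed (simp add: x0_eq)

lemma linf_subspace_F: "linf.subspace F"
  unfolding F_space_def by (intro linf_subspace_closure linf.subspace_span)

lemma closed_F: "closed F"
  by (simp add: F_space_def)

lemmas F_add = linf.subspace_add[OF linf_subspace_F]
  and F_scale = linf.subspace_scale[OF linf_subspace_F]
  and F_diff = linf.subspace_diff[OF linf_subspace_F]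
  and F_sum = linf.subspace_sum[OF linf_subspace_F]

lemma shift_by_x0_in_F: "shift_by m (x0 lam) \<in> F"
  unfolding F_space_def by (intro subsetD[OF closure_subset] linf.span_base rangeI)

text \<open>A shift is linear and isometric and permutes the generators, so it preserves their span
  and the closure of the span.\<close>

lemma shift_by_in_F:
  assumes "x \<in> F"
  shows "shift_by m x \<in> F"
proof -
  let ?S = "linf.span (range (\<lambda>m. shift_by m (x0 lam)))"
  have add: "shift_by m (x + y) = shift_by m x + shift_by m y"
    and scale: "shift_by m (cscale c x) = cscale c (shift_by m x)" for x y c
    by (auto intro!: bcontfun_eqI simp: shift_by_apply cscale_apply)
  have "shift_by m x \<in> ?S" if "x \<in> ?S" for x
    using that
  proof (induction rule: linf.span_induct_alt)
    case base
    have "shift_by m 0 = 0" by (rule bcontfun_eqI) (simp add: shift_by_apply)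
    then show ?case by (simp add: linf.span_zero)
  next
    case (step c x y)
    then obtain k where "x = shift_by k (x0 lam)" by auto
    then have "shift_by m x = shift_by (m + k) (x0 lam)"
      by (simp add: shift_by_add)
    then have "shift_by m x \<in> ?S"
      by (auto intro!: linf.span_base)
    with step show ?case
      by (simp add: add scale linf.span_add linf.span_scale)
  qed
  then have "shift_by m ` ?S \<subseteq> closure ?S"
    using closure_subset by blast
  then have "shift_by m ` closure ?S \<subseteq> closure ?S"
    by (intro image_closure_subset continuous_on_shift_by) auto
  then show ?thesis
    using assms unfolding F_space_def by blast
qed

lemma shift_image_F: "shift ` F = F"
proof (intro equalityI subsetI)
  fix x assume x: "x \<in> F"
  have "x = shift (shift_by (- 1) x)"
    by (rule bcontfun_eqI) (simp add: shift_by_apply)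
  then show "x \<in> shift ` F"
    using shift_by_in_F[OF x, of "- 1"] by blast
qed (auto intro: shift_by_in_F)

section \<open>The sequences \<open>y\<^sub>j\<close> of the overview and their finite
  combinations\<close>

definition comb :: "nat \<Rightarrow> linf" where
  "comb j = Bcontfun (\<lambda>n. if 2 ^ j dvd n then x0 lam (n div 2 ^ j) else 0)"

lemma comb_apply: "comb j n = (if 2 ^ j dvd n then x0 lam (n div 2 ^ j) else 0)"
  unfolding comb_def by (rule apply_Bcontfun[where B = 1]) (simp add: norm_x0_le)

lemma norm_comb_apply_le: "norm (comb j n) \<le> 1"
  by (simp add: comb_apply norm_x0_le)

text \<open>On multiples \<open>2 ^ j * q\<close>, the first summand covers even \<open>q\<close>
  and the second odd \<open>q\<close>, where the last binary digit contributes
  \<open>mu\<close>.\<close>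

lemma comb_rec: "comb j n = comb (Suc j) n + mu * comb (Suc j) (n - 2 ^ j)"
proof (cases "2 ^ j dvd n")
  case True
  then obtain q where q: "n = 2 ^ j * q" by (rule dvdE)
  have *: "comb (Suc j) (2 ^ j * x) = (if even x then x0 lam (x div 2) else 0)" for x
    by (simp add: comb_apply power_Suc2 del: power_Suc)
  have n: "n - 2 ^ j = 2 ^ j * (q - 1)"
    by (simp add: q algebra_simps)
  have "comb (Suc j) (n - 2 ^ j) = (if even q then 0 else x0 lam (q div 2))"
    unfolding n * by (auto elim!: oddE)
  moreover have "comb (Suc j) n = (if even q then x0 lam (q div 2) else 0)"
    unfolding q * ..
  moreover have "x0 lam 1 = mu"
    using digit_count_mask[of 1] by (simp add: x0_eq)
  then have "x0 lam q = (if even q then x0 lam (q div 2) else mu * x0 lam (q div 2))"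
    by (subst x0_split[of q 1]) (auto simp: mod2_eq_if)
  then have "comb j n = (if even q then x0 lam (q div 2) else mu * x0 lam (q div 2))"
    by (simp add: comb_apply q)
  ultimately show ?thesis
    by (cases "even q") (simp_all only: if_True if_False simp_thms add_0_left add_0_right mult_zero_right)
next
  case False
  moreover have "(2 :: int) ^ j dvd 2 ^ Suc j"
    by simp
  ultimately have "\<not> 2 ^ Suc j dvd n" "\<not> 2 ^ Suc j dvd n - 2 ^ j"
    by (blast intro: dvd_trans, metis dvd_diff_right_iff dvd_refl dvd_trans diff_add_cancel dvd_add)
  with False show ?thesis by (simp add: comb_apply del: power_Suc)
qed

text \<open>The recursion is solved for \<open>comb (Suc j)\<close> by a Neumann series in the
  operator \<open>mu\<close> times the shift by \<open>2 ^ j\<close>, which has norm below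
  1.\<close>

lemma comb_in_F: "comb j \<in> F"
proof (induction j)
  case 0
  have "comb 0 = shift_by 0 (x0 lam)"
    by (rule bcontfun_eqI) (simp add: comb_apply shift_by_apply)
  then show ?case using shift_by_x0_in_F by metis
next
  case (Suc j)
  let ?S = "\<lambda>N. \<Sum>k<N. cscale ((- mu) ^ k) (shift_by (int k * 2 ^ j) (comb j))"
  \<comment> \<open>Partial sum with its exact remainder; the remainder has norm at most
    \<open>norm mu ^ N\<close>.\<close>
  have eq: "comb (Suc j) n = ?S N n + (- mu) ^ N * comb (Suc j) (n - int N * 2 ^ j)" for N n
  proof (induction N)
    case (Suc N)
    have "n - int (Suc N) * 2 ^ j = n - int N * 2 ^ j - 2 ^ j"
      by (simp add: algebra_simps)
    with Suc show ?case
      by (simp add: linf_sum_apply cscale_apply shift_by_apply comb_rec[of j "n - int N * 2 ^ j"]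
          algebra_simps)
  qed simp
  have "norm (?S N - comb (Suc j)) \<le> norm mu ^ N" for N
  proof (rule norm_bound)
    fix n
    have "norm ((?S N - comb (Suc j)) n) = norm mu ^ N * norm (comb (Suc j) (n - int N * 2 ^ j))"
      using eq[of n N] by (simp add: norm_mult norm_power norm_minus_commute)
    also have "\<dots> \<le> norm mu ^ N * 1"
      by (intro mult_left_mono norm_comb_apply_le) simp
    finally show "norm ((?S N - comb (Suc j)) n) \<le> norm mu ^ N" by simp
  qed
  then have "?S \<longlonglongrightarrow> comb (Suc j)"
    using norm_mu
    by (intro metric_tendsto_imp_tendsto[OF LIMSEQ_power_zero[of "norm mu"]])
      (auto simp: dist_norm)
  moreover have "\<And>N. ?S N \<in> F"
    by (intro F_sum F_scale shift_by_in_F Suc.IH)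
  ultimately show ?case
    by (rule closed_sequentially[OF closed_F, rotated])
qed

text \<open>The translates in one window live on different residue classes modulo
  \<open>2 ^ j\<close>. Values of \<open>c\<close> outside the window are ignored.\<close>

definition spread :: "int \<Rightarrow> nat \<Rightarrow> (int \<Rightarrow> complex) \<Rightarrow> linf" where
  "spread m j c = (\<Sum>p\<in>{m..<m + 2 ^ j}. cscale (c p) (shift_by p (comb j)))"

lemma spread_in_F: "spread m j c \<in> F"
  unfolding spread_def by (intro F_sum F_scale shift_by_in_F comb_in_F)

text \<open>Only the point of the window congruent to \<open>n\<close> modulo \<open>2 ^ j\<close>
  contributes.\<close>

lemma spread_apply: "spread m j c n = c (m + (n - m) mod 2 ^ j) * x0 lam ((n - m) div 2 ^ j)"
proof -
  let ?p = "m + (n - m) mod 2 ^ j"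
  have p: "n - ?p = 2 ^ j * ((n - m) div 2 ^ j)"
    by (simp add: minus_mod_eq_mult_div flip: diff_diff_add)
  have "spread m j c n = (\<Sum>q\<in>{m..<m + 2 ^ j}. c q * comb j (n - q))"
    by (simp add: spread_def linf_sum_apply cscale_apply shift_by_apply)
  also have "\<dots> = (\<Sum>q\<in>{m..<m + 2 ^ j}. if q = ?p then c q * comb j (n - q) else 0)"
  proof (rule sum.cong[OF refl])
    fix q assume q: "q \<in> {m..<m + 2 ^ j}"
    have *: "q = ?p" if "2 ^ j dvd n - q"
    proof -
      have "(n - m) mod 2 ^ j = (q - m) mod 2 ^ j"
        using that by (simp add: mod_eq_dvd_iff)
      also have "\<dots> = q - m" using q by simp
      finally show ?thesis by simp
    qed
    show "c q * comb j (n - q) = (if q = ?p then c q * comb j (n - q) else 0)"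
    proof (cases "q = ?p")
      case False
      with * have "\<not> 2 ^ j dvd n - q" by blast
      then have "comb j (n - q) = 0"
        by (simp only: comb_apply if_False)
      with False show ?thesis by simp
    qed simp
  qed
  also have "\<dots> = c ?p * comb j (n - ?p)"
    by (simp add: sum.delta)
  also have "comb j (n - ?p) = x0 lam ((n - m) div 2 ^ j)"
    unfolding p comb_apply by simp
  finally show ?thesis .
qed

lemma spread_apply_base: "n \<in> {m..<m + 2 ^ j} \<Longrightarrow> spread m j c n = c n"
  by (simp add: spread_apply)

lemma norm_spread_le:
  assumes "\<And>p. norm (c p) \<le> B"
  shows "norm (spread m j c) \<le> B"
proof (rule norm_bound)
  fix n
  have "norm (spread m j c n) \<le> B * 1"
    unfolding spread_apply norm_mult
    using assms norm_x0_le order_trans[OF norm_ge_zero assms] by (intro mult_mono) auto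
  then show "norm (spread m j c n) \<le> B" by simp
qed

section \<open>Characterisation by limits along ultrafilters\<close>

definition limit_space :: "linf set" where
  "limit_space = {x. (\<forall>k\<ge>1. \<forall>t. \<forall>U\<in>X k t. beta_eval x U = mu ^ k * x t) \<and>
    (\<forall>U\<in>X_inf. beta_eval x U = 0)}"

text \<open>Both sides are linear and continuous in \<open>x\<close>, so it suffices to test the
  generators. The choice \<open>c = 0\<close> serves \<open>X_inf\<close>.\<close>

lemma F_beta_eval_eq:
  assumes U: "ultrafilter U"
    and gen: "\<And>m. beta_eval (shift_by m (x0 lam)) U = c * x0 lam (t - m)"
    and "x \<in> F"
  shows "beta_eval x U = c * x t"
proof -
  have "F \<subseteq> {x. beta_eval x U = c * x t}"
    unfolding F_space_def using gen
    by (intro closure_minimal linf.span_minimal closed_beta_eval_eq U linf_subspace_beta_eval_eq)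
      (auto simp: shift_by_apply)
  with \<open>x \<in> F\<close> show ?thesis by blast
qed

text \<open>Along \<open>U\<close> the \<open>k\<close> ones of \<open>j - t\<close> move to
  arbitrarily high positions. If \<open>t - m\<close> is nonnegative they avoid its digits and the
  factors multiply; if it is negative, the borrow creates arbitrarily long runs of ones and the
  limit is 0.\<close>

lemma beta_eval_shift_x0_X:
  assumes "1 \<le> k" and U: "U \<in> X k t"
  shows "beta_eval (shift_by m (x0 lam)) U = mu ^ k * x0 lam (t - m)"
proof (rule beta_eval_eqI)
  show "ultrafilter U"
    using U X_subset_Zstar Zstar_imp_ultrafilter by blast
  have ev: "eventually (\<lambda>j. t \<le> j \<and> 2 ^ r dvd j - t \<and> digit_count (j - t) = k) U" for r
    using X_iff[OF assms(1)] U by blast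
  let ?s = "t - m"
  show "(shift_by m (x0 lam) \<longlongrightarrow> mu ^ k * x0 lam ?s) U"
  proof (cases "0 \<le> ?s")
    case True
    have s: "?s < 2 ^ nat ?s"
      using True of_nat_less_two_power[of "nat ?s", where 'a = int] by simp
    have "eventually (\<lambda>j. shift_by m (x0 lam) j = mu ^ k * x0 lam ?s) U"
      using ev[of "nat ?s"]
    proof eventually_elim
      case (elim j)
      then obtain q where q: "j - t = 2 ^ nat ?s * q" by (auto elim: dvdE)
      with elim have "0 \<le> q"
        by (metis diff_ge_0_iff_ge zero_le_mult_iff zero_less_numeral zero_less_power not_le)
      have j: "j - m = ?s + 2 ^ nat ?s * q" using q by simp
      have "(j - m) mod 2 ^ nat ?s = ?s" "(j - m) div 2 ^ nat ?s = q"
        using True s by (simp_all add: j)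
      moreover have "digit_count q = k"
        using elim q digit_count_mult_power[OF \<open>0 \<le> q\<close>] by simp
      ultimately have "x0 lam (j - m) = x0 lam ?s * mu ^ k"
        using x0_split[of "j - m" "nat ?s"] x0_eq[of q] \<open>0 \<le> q\<close> by simp
      then show ?case by (simp add: shift_by_apply mult.commute)
    qed
    then show ?thesis by (rule tendsto_eventually)
  next
    case False
    define r0 where "r0 = nat (- ?s)"
    have r0: "- ?s < 2 ^ r0"
      using False of_nat_less_two_power[of r0, where 'a = int] by (simp add: r0_def)
    have le: "eventually (\<lambda>j. norm (x0 lam (j - m)) \<le> norm mu ^ r) U" for r
      using ev[of "r0 + r"]
    proof eventually_elim
      case (elim j)
      then obtain q where q: "j - t = 2 ^ (r0 + r) * q" by (auto elim: dvdE)
      \<comment> \<open>The borrow: \<open>?s + 2 ^ r0\<close> lies between 0 and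
        \<open>2 ^ r0\<close>, and the quotient \<open>2 ^ r * q - 1\<close> ends in
        \<open>r\<close> ones.\<close>
      have j: "j - m = (?s + 2 ^ r0) + 2 ^ r0 * (2 ^ r * q - 1)"
        using q by (simp add: power_add algebra_simps)
      have div: "(j - m) div 2 ^ r0 = 2 ^ r * q - 1"
        unfolding j using False r0 by (subst div_mult_self2) auto
      have "(2 ^ r * q - 1) mod 2 ^ r = (2 ^ r - 1 :: int)"
      proof -
        have "(2 ^ r * q - 1) mod 2 ^ r = (- 1 :: int) mod 2 ^ r"
          by (simp add: mod_eq_dvd_iff)
        then show ?thesis by (simp add: zmod_minus1)
      qed
      then have "x0 lam (2 ^ r * q - 1) = mu ^ r * x0 lam ((2 ^ r * q - 1) div 2 ^ r)"
        using x0_split[of "2 ^ r * q - 1" r] x0_eq[of "2 ^ r - 1"] by (simp add: digit_count_mask)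
      then have "x0 lam (j - m) = x0 lam ((j - m) mod 2 ^ r0) * (mu ^ r * x0 lam ((2 ^ r * q - 1) div 2 ^ r))"
        using x0_split[of "j - m" r0] div by simp
      also have "norm \<dots> \<le> 1 * (norm mu ^ r * 1)"
        unfolding norm_mult norm_power by (intro mult_mono norm_x0_le) auto
      finally show ?case by simp
    qed
    have "((\<lambda>j. x0 lam (j - m)) \<longlongrightarrow> 0) U"
    proof (rule tendstoI)
      fix e :: real assume "0 < e"
      then obtain r where "norm mu ^ r < e"
        using real_arch_pow_inv[OF _ norm_mu] by blast
      with le[of r] show "eventually (\<lambda>j. dist (x0 lam (j - m)) 0 < e) U"
        by (auto elim: eventually_mono)
    qed
    then show ?thesis
      using False by (simp add: shift_by_apply[abs_def] x0_eq[of ?s])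
  qed
qed

text \<open>A nonzero limit bounds the digit count of \<open>j - m\<close> along \<open>U\<close>,
  so that it is a constant \<open>d\<close>. The ones whose positions stabilise add up to a fixed
  integer \<open>s\<close>, and the remaining ones escape upwards, which would put \<open>U\<close>
  into some \<open>X k (s + m)\<close>.\<close>

lemma beta_eval_shift_x0_X_inf:
  assumes "U \<in> X_inf"
  shows "beta_eval (shift_by m (x0 lam)) U = 0"
proof (rule ccontr)
  define l where "l = beta_eval (shift_by m (x0 lam)) U"
  assume "beta_eval (shift_by m (x0 lam)) U \<noteq> 0"
  then have "0 < norm l / 2" by (simp add: l_def)
  have Z: "U \<in> Zstar" and U: "ultrafilter U"
    using assms X_inf_subset_Zstar Zstar_imp_ultrafilter by blast+
  have nt: "U \<noteq> bot" using U by (simp add: ultrafilter_def)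
  have lim: "((\<lambda>j. x0 lam (j - m)) \<longlongrightarrow> l) U"
    using tendsto_beta_eval[OF U, of "shift_by m (x0 lam)"] by (simp add: l_def shift_by_apply[abs_def])
  obtain r where r: "norm mu ^ r < norm l / 2"
    using real_arch_pow_inv[OF \<open>0 < norm l / 2\<close> norm_mu] by blast
  have ev: "eventually (\<lambda>j. m \<le> j \<and> digit_count (j - m) < r) U"
    using tendstoD[OF lim \<open>0 < norm l / 2\<close>]
  proof eventually_elim
    case (elim j)
    have "norm l \<le> norm (x0 lam (j - m)) + dist (x0 lam (j - m)) l"
      by (metis dist_norm norm_minus_commute norm_triangle_sub add.commute)
    with elim have *: "norm mu ^ r < norm (x0 lam (j - m))"
      using r by linarith
    then have "m \<le> j"
      using zero_le_power[OF norm_ge_zero, of mu r] by (auto simp: x0_eq split: if_splits)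
    moreover have "digit_count (j - m) < r"
    proof (rule ccontr)
      assume "\<not> ?thesis"
      then have "norm mu ^ digit_count (j - m) \<le> norm mu ^ r"
        using norm_mu by (intro power_decreasing) auto
      with * \<open>m \<le> j\<close> show False by (simp add: x0_eq norm_power norm_inverse)
    qed
    ultimately show ?case ..
  qed
  then have "eventually (\<lambda>j. \<exists>d\<in>{..<r}. m \<le> j \<and> digit_count (j - m) = d) U"
    by (auto elim: eventually_mono)
  then obtain d where d: "eventually (\<lambda>j. m \<le> j \<and> digit_count (j - m) = d) U"
    by (rule ultrafilter_eventually_finite_ex[OF U finite_lessThan])
  define S where "S = {i. eventually (\<lambda>j. bit (j - m) i) U}"
  \<comment> \<open>Finitely many stable positions are ones of a common \<open>j - m\<close>, whose
    digit count is \<open>d\<close>.\<close>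
  have "finite T \<and> card T \<le> d" if "T \<subseteq> S" "finite T" for T
  proof -
    have "eventually (\<lambda>j. \<forall>i\<in>T. bit (j - m) i) U"
      using that by (intro eventually_ball_finite) (auto simp: S_def)
    with d have "eventually (\<lambda>j. T \<subseteq> {i. bit (j - m) i} \<and> m \<le> j \<and> digit_count (j - m) = d) U"
      by eventually_elim auto
    then obtain j where "T \<subseteq> {i. bit (j - m) i}" "m \<le> j" "digit_count (j - m) = d"
      using eventually_happens'[OF nt] by blast
    then show ?thesis
      using card_mono[OF finite_bits[of "j - m"]] that by (auto simp: digit_count_def)
  qed
  then have finS: "finite S"
    using finite_if_finite_subsets_card_bdd[of S d] by blast
  define s :: int where "s = (\<Sum>i\<in>S. 2 ^ i)"
  have bit_s: "bit s i \<longleftrightarrow> i \<in> S" for i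
    unfolding s_def by (rule bit_sum_power_iff[OF finS])
  obtain M0 where M0: "\<And>i. i \<in> S \<Longrightarrow> i < M0"
    using finS unfolding finite_nat_set_iff_bounded by auto
  define k where "k = d - digit_count s"
  have ev2: "eventually (\<lambda>j. s + m \<le> j \<and> 2 ^ M dvd j - (s + m) \<and> digit_count (j - (s + m)) = k) U" for M
  proof -
    \<comment> \<open>Beyond \<open>M0\<close> there is no stable one, so the lowest
      \<open>?M\<close> digits of \<open>j - m\<close> are exactly those of
      \<open>s\<close>.\<close>
    let ?M = "max M M0"
    have "eventually (\<lambda>j. bit (j - m) i \<longleftrightarrow> i \<in> S) U" for i
      using ultrafilter_eventually_not[OF U, of "\<lambda>j. bit (j - m) i"] by (cases "i \<in> S") (auto simp: S_def)
    then have "eventually (\<lambda>j. \<forall>i\<in>{..<?M}. bit (j - m) i \<longleftrightarrow> i \<in> S) U"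
      by (intro eventually_ball_finite) auto
    with d show ?thesis
    proof eventually_elim
      case (elim j)
      have "take_bit ?M (j - m) = s"
        using elim M0 by (intro bit_eqI) (auto simp: bit_take_bit_iff bit_s less_max_iff_disj)
      then have s: "(j - m) mod 2 ^ ?M = s" by (simp add: take_bit_eq_mod)
      define q where "q = (j - m) div 2 ^ ?M"
      have q: "j - (s + m) = 2 ^ ?M * q"
        unfolding q_def using s by (metis diff_diff_eq2 diff_diff_add minus_mod_eq_mult_div add.commute)
      have "0 \<le> q" using elim by (simp add: q_def pos_imp_zdiv_nonneg_iff)
      have "digit_count (j - m) = digit_count s + digit_count q"
        using digit_count_split[of "j - m" ?M] elim s by (simp add: q_def)
      then have "digit_count (j - (s + m)) = k"
        using elim unfolding q digit_count_mult_power[OF \<open>0 \<le> q\<close>] by (simp add: k_def)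
      moreover have "0 \<le> j - (s + m)"
        unfolding q using \<open>0 \<le> q\<close> by simp
      moreover have "2 ^ M dvd j - (s + m)"
        unfolding q by (intro dvd_mult2 le_imp_power_dvd) simp
      ultimately show ?case by simp
    qed
  qed
  \<comment> \<open>With no escaping ones \<open>U\<close> would concentrate on the single point
    \<open>s + m\<close> and be principal.\<close>
  have "1 \<le> k"
  proof (rule ccontr)
    assume "\<not> 1 \<le> k"
    have "eventually (\<lambda>j. j = s + m) U"
      using ev2[of 0]
    proof eventually_elim
      case (elim j)
      then show ?case
        using digit_count_pos[of "j - (s + m)"] \<open>\<not> 1 \<le> k\<close> by linarith
    qed
    then show False
      using ultrafilter_eq_principal[OF U] Z by (auto simp: Zstar_def)
  qed
  then have "U \<in> X k (s + m)"
    using X_iff Z ev2 by blast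
  with \<open>1 \<le> k\<close> assms show False
    by (auto simp: X_inf_def)
qed

lemma F_subset_limit_space: "F \<subseteq> limit_space"
proof
  fix x assume x: "x \<in> F"
  have "beta_eval x U = mu ^ k * x t" if "1 \<le> k" "U \<in> X k t" for k t U
    using that x X_subset_Zstar Zstar_imp_ultrafilter beta_eval_shift_x0_X
    by (intro F_beta_eval_eq) blast+
  moreover have "beta_eval x U = 0 * x 0" if "U \<in> X_inf" for U
    using that x X_inf_subset_Zstar Zstar_imp_ultrafilter beta_eval_shift_x0_X_inf
    by (intro F_beta_eval_eq) auto
  ultimately show "x \<in> limit_space"
    by (simp add: limit_space_def)
qed

section \<open>The converse inclusion: approximation from \<open>F\<close>\<close>

lemma limit_space_diff:
  assumes "x \<in> limit_space" "y \<in> limit_space"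
  shows "x - y \<in> limit_space"
proof -
  have "U \<in> X k t \<Longrightarrow> beta_eval (x - y) U = beta_eval x U - beta_eval y U"
    and "U \<in> X_inf \<Longrightarrow> beta_eval (x - y) U = beta_eval x U - beta_eval y U" for U k t
    using X_subset_Zstar X_inf_subset_Zstar Zstar_imp_ultrafilter beta_eval_diff by blast+
  with assms show ?thesis
    by (simp add: limit_space_def right_diff_distrib)
qed

text \<open>Every prescribed limit is 0 or carries a factor \<open>mu ^ k\<close> with
  \<open>k\<close> at least 1.\<close>

lemma norm_beta_eval_limit_space_le:
  assumes x: "x \<in> limit_space" and "U \<in> Zstar"
  shows "norm (beta_eval x U) \<le> norm mu * norm x"
proof (cases "U \<in> X_inf")
  case True
  then have "beta_eval x U = 0" using x by (simp add: limit_space_def)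
  then show ?thesis by simp
next
  case False
  with \<open>U \<in> Zstar\<close> obtain k t where "1 \<le> k" "U \<in> X k t"
    by (auto simp: X_inf_def)
  then have "norm (beta_eval x U) = norm mu ^ k * norm (x t)"
    using x by (simp add: limit_space_def norm_mult norm_power)
  also have "norm mu ^ k \<le> norm mu ^ 1"
    using \<open>1 \<le> k\<close> norm_mu by (intro power_decreasing) auto
  then have "norm mu ^ k * norm (x t) \<le> norm mu * norm x"
    by (intro mult_mono norm_bounded) auto
  finally show ?thesis .
qed

text \<open>An infinite set of large values would carry a non-principal ultrafilter, along which the
  limit is too large.\<close>

lemma finite_large_limit_space:
  assumes x: "x \<in> limit_space" and "0 < e"
  shows "finite {n. norm mu * norm x + e < norm (x n)}"
proof (rule ccontr)
  assume "infinite {n. norm mu * norm x + e < norm (x n)}"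
  then obtain U where U: "U \<in> Zstar"
    "eventually (\<lambda>n. n \<in> {n. norm mu * norm x + e < norm (x n)}) U"
    by (rule ultrafilter_in_infinite_set)
  have "norm mu * norm x + e \<le> norm (beta_eval x U)"
  proof (rule tendsto_lowerbound)
    show "((\<lambda>n. norm (x n)) \<longlongrightarrow> norm (beta_eval x U)) U"
      by (intro tendsto_norm tendsto_beta_eval Zstar_imp_ultrafilter U)
    show "eventually (\<lambda>n. norm mu * norm x + e \<le> norm (x n)) U"
      using U(2) by (auto elim: eventually_mono)
    show "U \<noteq> bot"
      using Zstar_imp_ultrafilter[OF U(1)] by (simp add: ultrafilter_def)
  qed
  with norm_beta_eval_limit_space_le[OF x U(1)] \<open>0 < e\<close> show False by simp
qed

text \<open>The limit condition on all of \<open>X k p\<close> is made uniform. If every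
  \<open>M\<close> failed, the nested sets \<open>B M\<close> of counterexamples would generate a
  proper filter, and an ultrafilter below it would lie in \<open>X k p\<close> and violate the
  condition.\<close>

lemma limit_space_near:
  assumes x: "x \<in> limit_space" and "1 \<le> k" and "0 < e"
  shows "\<exists>M. \<forall>n. p \<le> n \<and> 2 ^ M dvd n - p \<and> digit_count (n - p) = k \<longrightarrow> norm (x n - mu ^ k * x p) < e"
proof (rule ccontr)
  define B where "B = (\<lambda>M. {n. p \<le> n \<and> 2 ^ M dvd n - p \<and> digit_count (n - p) = k \<and>
    \<not> norm (x n - mu ^ k * x p) < e})"
  assume "\<not> ?thesis"
  then have ne: "B M \<noteq> {}" for M
    by (auto simp: B_def)
  have mono: "B N \<subseteq> B M" if "M \<le> N" for M N
    using that by (auto simp: B_def intro: dvd_trans[OF le_imp_power_dvd])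
  have "\<exists>N. B N \<subseteq> B M \<and> B N \<subseteq> B M'" for M M'
    using mono[of M "max M M'"] mono[of M' "max M M'"] by auto
  then have ev: "eventually P (INF M. principal (B M)) \<longleftrightarrow> (\<exists>M. \<forall>n\<in>B M. P n)" for P
    by (subst eventually_INF_base) (auto simp: eventually_principal)
  then have "(INF M. principal (B M)) \<noteq> bot"
    using ne by (auto simp: trivial_limit_def)
  then obtain U where U: "ultrafilter U" "U \<le> (INF M. principal (B M))"
    by (rule ultrafilter_exists)
  have evU: "eventually (\<lambda>n. n \<in> B M) U" for M
    using U(2) ev[of "\<lambda>n. n \<in> B M"] by (auto intro: filter_leD)
  \<comment> \<open>A point of all \<open>B M\<close> differs from \<open>p\<close> by a multiple of
    every power of 2, hence equals \<open>p\<close>, against \<open>1 \<le> k\<close>.\<close>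
  have "U \<noteq> principal {n}" for n
  proof
    assume "U = principal {n}"
    then have n: "n \<in> B M" for M
      using evU by (simp add: eventually_principal)
    let ?M = "nat (n - p)"
    have "0 \<le> n - p" using n[of 0] by (simp add: B_def)
    then have "n - p < 2 ^ ?M"
      using of_nat_less_two_power[of ?M, where 'a = int] by simp
    moreover have "2 ^ ?M dvd n - p" using n[of ?M] by (simp add: B_def)
    ultimately have "n - p = 0"
      using \<open>0 \<le> n - p\<close> zdvd_not_zless[of "n - p" "2 ^ ?M"] by linarith
    then show False using n[of 0] \<open>1 \<le> k\<close> by (simp add: B_def)
  qed
  moreover have "eventually (\<lambda>n. p \<le> n \<and> 2 ^ M dvd n - p \<and> digit_count (n - p) = k) U" for M
    using evU[of M] by (rule eventually_mono) (simp add: B_def)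
  ultimately have "U \<in> X k p"
    using X_iff[OF \<open>1 \<le> k\<close>] U(1) by (simp add: Zstar_def)
  then have "beta_eval x U = mu ^ k * x p"
    using x \<open>1 \<le> k\<close> by (simp add: limit_space_def)
  then have "eventually (\<lambda>n. dist (x n) (mu ^ k * x p) < e) U"
    using tendstoD[OF tendsto_beta_eval[OF U(1)] \<open>0 < e\<close>, of x] by simp
  with evU[of 0] have "eventually (\<lambda>_. False) U"
    by eventually_elim (simp add: B_def dist_norm)
  with U(1) show False by (simp add: ultrafilter_def trivial_limit_def)
qed

text \<open>\<open>w\<close> interpolates \<open>x\<close> on the finite set \<open>A\<close> of
  large values. At another point \<open>p + 2 ^ j * q\<close> with \<open>p\<close> in
  \<open>A\<close> and \<open>q > 0\<close>, the number \<open>k\<close> of ones of \<open>q\<close>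
  decides: for \<open>k < K\<close>, \<open>x\<close> nearly equals \<open>w\<close> there; for
  larger \<open>k\<close>, \<open>w\<close> is at most \<open>e\<close> and \<open>x\<close> is not
  large.\<close>

lemma limit_space_approx_step:
  assumes x: "x \<in> limit_space" and "0 < e"
  shows "\<exists>w\<in>F. norm (x - w) \<le> norm mu * norm x + 2 * e"
proof -
  let ?b = "norm mu * norm x + e"
  define A where "A = {n. ?b < norm (x n)}"
  have finA: "finite A"
    unfolding A_def by (rule finite_large_limit_space[OF assms])
  obtain m j0 where window: "\<And>j. j0 \<le> j \<Longrightarrow> A \<subseteq> {m..<m + 2 ^ j}"
    using finite_int_subset_window[OF finA] by meson
  have "0 < e / (norm x + 1)"
    using \<open>0 < e\<close> by (simp add: add_nonneg_pos)
  then obtain K where K: "norm mu ^ K < e / (norm x + 1)"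
    using real_arch_pow_inv[OF _ norm_mu] by blast
  have muK: "norm (mu ^ k * x p) \<le> e" if "K \<le> k" for k p
  proof -
    have "norm mu ^ k \<le> norm mu ^ K"
      using that norm_mu by (intro power_decreasing) auto
    then have "norm (mu ^ k * x p) \<le> norm mu ^ K * (norm x + 1)"
      unfolding norm_mult norm_power using norm_bounded[of x p] by (intro mult_mono) auto
    also have "\<dots> \<le> e"
      using K by (simp add: pos_less_divide_eq add_nonneg_pos)
    finally show ?thesis .
  qed
  have "\<forall>p k. 1 \<le> k \<longrightarrow> (\<exists>M. \<forall>n. p \<le> n \<and> 2 ^ M dvd n - p \<and> digit_count (n - p) = k
      \<longrightarrow> norm (x n - mu ^ k * x p) < e)"
    using limit_space_near[OF x _ \<open>0 < e\<close>] by blast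
  then obtain M where M: "\<And>p k n. 1 \<le> k \<Longrightarrow> p \<le> n \<Longrightarrow> 2 ^ M p k dvd n - p \<Longrightarrow>
      digit_count (n - p) = k \<Longrightarrow> norm (x n - mu ^ k * x p) < e"
    by metis
  \<comment> \<open>Only finitely many pairs \<open>(p, k)\<close> matter, so one mesh can beat all
    their thresholds and also put \<open>A\<close> into the window.\<close>
  define j where "j = Max (insert j0 ((\<lambda>(p, k). M p k) ` (A \<times> {..<K})))"
  have "j0 \<le> j" unfolding j_def using finA by (intro Max_ge) auto
  have Mj: "M p k \<le> j" if "p \<in> A" "k < K" for p k
    unfolding j_def using finA that by (intro Max_ge) auto
  define c where "c = (\<lambda>p. if p \<in> A then x p else 0)"
  define w where "w = spread m j c"
  have "norm ((x - w) n) \<le> ?b + e" for n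
  proof -
    define p where "p = m + (n - m) mod 2 ^ j"
    define q where "q = (n - m) div 2 ^ j"
    have n: "n - p = 2 ^ j * q"
      unfolding p_def q_def by (simp add: minus_mod_eq_mult_div flip: diff_diff_add)
    have w: "w n = c p * x0 lam q"
      by (simp add: w_def spread_apply p_def q_def)
    have A0: "q = 0" if "n \<in> A"
      using window[OF \<open>j0 \<le> j\<close>] that by (auto simp: q_def)
    \<comment> \<open>If \<open>p\<close> is outside \<open>A\<close> or \<open>q < 0\<close>, then
      \<open>w\<close> vanishes at \<open>n\<close>; if \<open>q = 0\<close>, then
      \<open>n = p\<close> and \<open>w\<close> agrees with \<open>x\<close>.\<close>
    consider "p \<notin> A" | "p \<in> A" "q = 0" | "q < 0" | "p \<in> A" "0 < q" by linarith
    then show ?thesis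
    proof cases
      case 1
      then have "n \<notin> A" using A0 n by auto
      then show ?thesis
        using 1 \<open>0 < e\<close> by (simp add: w c_def A_def)
    next
      case 2
      then have "w n = x n" using n w by (simp add: c_def)
      then show ?thesis using \<open>0 < e\<close> by simp
    next
      case 3
      then have "n \<notin> A" using A0 by auto
      then show ?thesis
        using 3 \<open>0 < e\<close> by (simp add: w x0_eq A_def)
    next
      case 4
      define k where "k = digit_count q"
      have "1 \<le> k" using digit_count_pos[of q] 4 by (simp add: k_def)
      have wk: "w n = mu ^ k * x p"
        using 4 by (simp add: w c_def x0_eq k_def)
      show ?thesis
      proof (cases "k < K")
        case True
        have "norm (x n - mu ^ k * x p) < e"
        proof (rule M[OF \<open>1 \<le> k\<close>])
          show "p \<le> n"
            using n 4 by (metis diff_ge_0_iff_ge less_imp_le mult_pos_pos zero_less_numeral zero_less_power)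
          show "2 ^ M p k dvd n - p"
            unfolding n using Mj[OF \<open>p \<in> A\<close> True] by (intro dvd_mult2 le_imp_power_dvd)
          show "digit_count (n - p) = k"
            unfolding n k_def using 4 by (simp add: digit_count_mult_power)
        qed
        moreover have "0 \<le> ?b" using \<open>0 < e\<close> by simp
        ultimately show ?thesis by (simp add: wk)
      next
        case False
        have "n \<notin> A" using A0 4 by auto
        then have "norm (x n) \<le> ?b" by (simp add: A_def)
        with muK[of k p] False show ?thesis
          using norm_triangle_ineq4[of "x n" "w n"] by (simp add: wk)
      qed
    qed
  qed
  then have "norm (x - w) \<le> ?b + e" by (rule norm_bound)
  moreover have "w \<in> F" unfolding w_def by (rule spread_in_F)
  ultimately show ?thesis
    by (intro bexI[of _ w]) auto
qed

lemma limit_space_approx: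
  assumes "x \<in> limit_space" "0 < e"
  shows "\<exists>w\<in>F. norm (x - w) \<le> norm mu ^ r * norm x + e"
  using assms
proof (induction r arbitrary: x e)
  case 0
  then show ?case
    using linf.subspace_0[OF linf_subspace_F] by (intro bexI[of _ 0]) auto
next
  case (Suc r)
  \<comment> \<open>The approximation step doubles its tolerance, so half of \<open>e\<close> is
    left for the induction hypothesis.\<close>
  have "0 < e / 4" using Suc.prems by simp
  from limit_space_approx_step[OF Suc.prems(1) this]
  obtain v where v: "v \<in> F" "norm (x - v) \<le> norm mu * norm x + e / 2" by auto
  then have "x - v \<in> limit_space"
    using F_subset_limit_space Suc.prems limit_space_diff by blast
  then obtain w where w: "w \<in> F" "norm (x - v - w) \<le> norm mu ^ r * norm (x - v) + e / 2"
    using Suc.IH[of "x - v" "e / 2"] Suc.prems by auto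
  note w(2)
  also have "norm mu ^ r * norm (x - v) \<le> norm mu ^ r * (norm mu * norm x + e / 2)"
    using v by (intro mult_left_mono) auto
  also have "\<dots> = norm mu ^ Suc r * norm x + norm mu ^ r * (e / 2)"
    by (simp add: algebra_simps)
  also have "norm mu ^ r * (e / 2) \<le> 1 * (e / 2)"
    using norm_mu Suc.prems by (intro mult_right_mono power_le_one) auto
  finally have "norm (x - (v + w)) \<le> norm mu ^ Suc r * norm x + e"
    by (simp add: algebra_simps)
  then show ?case using F_add[OF v(1) w(1)] by blast
qed

lemma F_eq_limit_space: "F = limit_space"
proof (rule antisym[OF F_subset_limit_space], rule subsetI)
  fix x assume x: "x \<in> limit_space"
  have "\<exists>w\<in>F. dist w x < e" if e: "0 < e" for e
  proof -
    have "0 < e / 2 / (norm x + 1)"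
      using that by (simp add: add_nonneg_pos)
    then obtain r where r: "norm mu ^ r < e / 2 / (norm x + 1)"
      using real_arch_pow_inv[OF _ norm_mu] by blast
    have "norm mu ^ r * norm x \<le> norm mu ^ r * (norm x + 1)"
      by (intro mult_left_mono) auto
    also have "\<dots> < e / 2"
      using r by (simp only: pos_less_divide_eq add_nonneg_pos norm_ge_zero zero_less_one)
    finally have "norm mu ^ r * norm x < e / 2" .
    moreover obtain w where "w \<in> F" "norm (x - w) \<le> norm mu ^ r * norm x + e / 2"
      using limit_space_approx[OF x half_gt_zero[OF e]] by blast
    ultimately show ?thesis
      by (intro bexI[of _ w]) (auto simp: dist_norm norm_minus_commute)
  qed
  then have "x \<in> closure F" by (simp add: closure_approachable)
  then show "x \<in> F" using closed_F by simp
qed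

section \<open>The dual space\<close>

text \<open>Conjugate phases of \<open>a\<close> are interpolated on a finite set carrying most of
  its mass, without leaving the unit ball. This makes \<open>iota\<close> isometric.\<close>

lemma F_norming:
  assumes a: "a \<in> ell1" and "0 < e"
  shows "\<exists>w\<in>F. norm w \<le> 1 \<and> ell1_norm a \<le> norm (pairing w a) + e"
proof -
  obtain A where A: "finite A" "ell1_norm a \<le> (\<Sum>n\<in>A. norm (a n)) + e / 2"
    "\<And>x :: linf. norm (pairing x a - (\<Sum>n\<in>A. x n * a n)) \<le> e / 2 * norm x"
    using pairing_approx[OF a half_gt_zero[OF \<open>0 < e\<close>]] by blast
  obtain m j where window: "A \<subseteq> {m..<m + 2 ^ j}"
    using finite_int_subset_window[OF A(1)] by blast
  define w where "w = spread m j (\<lambda>p. cnj (sgn (a p)))"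
  have w1: "norm w \<le> 1"
    unfolding w_def by (intro norm_spread_le norm_cnj_sgn_le)
  have "(\<Sum>n\<in>A. w n * a n) = of_real (\<Sum>n\<in>A. norm (a n))"
    unfolding of_real_sum
  proof (rule sum.cong[OF refl])
    fix n assume "n \<in> A"
    with window have "w n = cnj (sgn (a n))"
      unfolding w_def by (intro spread_apply_base) auto
    then show "w n * a n = of_real (norm (a n))"
      by (simp only: cnj_sgn_mult)
  qed
  moreover have "norm (of_real (\<Sum>n\<in>A. norm (a n)) :: complex) = (\<Sum>n\<in>A. norm (a n))"
    unfolding norm_of_real by (simp add: sum_nonneg)
  moreover have "e / 2 * norm w \<le> e / 2 * 1"
    using w1 \<open>0 < e\<close> by (intro mult_left_mono) auto
  ultimately have "(\<Sum>n\<in>A. norm (a n)) \<le> norm (pairing w a) + e / 2"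
    using A(3)[of w] norm_triangle_ineq2[of "\<Sum>n\<in>A. w n * a n" "pairing w a"]
    by (simp add: norm_minus_commute)
  with A(2) w1 show ?thesis
    using spread_in_F by (intro bexI[of _ w]) (auto simp: w_def)
qed

lemma iota_isometry:
  assumes a: "a \<in> ell1" and b: "b \<in> ell1"
  shows "dual_dist F (iota F a) (iota F b) = ell1_dist a b"
proof -
  let ?d = "\<lambda>n. a n - b n" and ?B = "{x\<in>F. norm x \<le> 1}"
  have d: "?d \<in> ell1" by (rule ell1_diff[OF a b])
  have "dual_dist F (iota F a) (iota F b) = (SUP x\<in>?B. norm (pairing x ?d))"
    unfolding dual_dist_def dual_norm_def using iota_in_dual[OF linf_subspace_F] a b
    by (auto simp: iota_def pairing_diff_right intro!: SUP_cong)
  also have "\<dots> = ell1_norm ?d"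
  proof (rule antisym)
    have le: "norm (pairing x ?d) \<le> ell1_norm ?d" if "x \<in> ?B" for x
    proof -
      have "0 \<le> ell1_norm ?d" by (simp add: ell1_norm_def infsum_nonneg)
      then have "ell1_norm ?d * norm x \<le> ell1_norm ?d * 1"
        using that by (intro mult_left_mono) auto
      with norm_pairing_le[OF d, of x] show ?thesis by simp
    qed
    have "0 \<in> ?B" using linf.subspace_0[OF linf_subspace_F] by simp
    then show "(SUP x\<in>?B. norm (pairing x ?d)) \<le> ell1_norm ?d"
      using le by (intro cSUP_least) auto
    have bdd: "bdd_above ((\<lambda>x. norm (pairing x ?d)) ` ?B)"
      using le by (auto simp: bdd_above_def)
    show "ell1_norm ?d \<le> (SUP x\<in>?B. norm (pairing x ?d))"
    proof (rule field_le_epsilon)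
      fix e :: real assume "0 < e"
      then obtain w where "w \<in> ?B" "ell1_norm ?d \<le> norm (pairing w ?d) + e"
        using F_norming[OF d] by blast
      with cSUP_upper[OF _ bdd, of w] show "ell1_norm ?d \<le> (SUP x\<in>?B. norm (pairing x ?d)) + e"
        by simp
    qed
  qed
  finally show ?thesis by (simp add: ell1_dist_def)
qed

section \<open>Surjectivity of \<open>iota\<close>\<close>

lemma comb_diff_apply_eq_0:
  assumes "\<not> 2 ^ l dvd n \<or> 2 ^ Suc l dvd n"
  shows "comb l n - comb (Suc l) n = 0"
  using assms
proof
  assume "\<not> 2 ^ l dvd n"
  moreover have "(2 :: int) ^ l dvd 2 ^ Suc l" by simp
  ultimately have "\<not> 2 ^ Suc l dvd n" by (blast intro: dvd_trans)
  with \<open>\<not> 2 ^ l dvd n\<close> show ?thesis by (simp only: comb_apply if_False diff_self)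
next
  assume dvd: "2 ^ Suc l dvd n"
  have "\<not> 2 ^ Suc l dvd n - 2 ^ l"
  proof
    assume "2 ^ Suc l dvd n - 2 ^ l"
    with dvd have "2 ^ Suc l dvd n - (n - 2 ^ l)" by (rule dvd_diff)
    then show False by simp
  qed
  then have "comb (Suc l) (n - 2 ^ l) = 0" by (simp only: comb_apply if_False)
  then show ?thesis by (subst comb_rec) simp
qed

lemma norm_comb_diff_le: "norm (comb l n - comb (Suc l) n) \<le> 1"
proof -
  have "comb l n - comb (Suc l) n = mu * comb (Suc l) (n - 2 ^ l)"
    by (subst comb_rec) simp
  also have "norm \<dots> \<le> 1 * 1"
    unfolding norm_mult using norm_mu norm_comb_apply_le by (intro mult_mono) auto
  finally show ?thesis by simp
qed

text \<open>The differences \<open>comb l - comb (Suc l)\<close> have pairwise disjoint supports.\<close>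

lemma norm_comb_diff_sum_le:
  assumes c: "\<And>l. norm (c l) \<le> 1"
  shows "norm (\<Sum>l<N. cscale (c l) (shift_by t (comb l - comb (Suc l)))) \<le> 1"
proof (rule norm_bound)
  fix n
  let ?s = "\<lambda>N. \<Sum>l<N. c l * (comb l (n - t) - comb (Suc l) (n - t))"
  \<comment> \<open>The term with index \<open>l\<close> can be nonzero only if \<open>2 ^ l\<close>
    is the exact power of 2 in \<open>n - t\<close>. So none of the first \<open>N\<close> terms
    survives when \<open>2 ^ N\<close> divides \<open>n - t\<close>, and the next term starts from
    0.\<close>
  have "norm (?s N) \<le> 1 \<and> (2 ^ N dvd n - t \<longrightarrow> ?s N = 0)"
  proof (induction N)
    case (Suc N)
    let ?d = "c N * (comb N (n - t) - comb (Suc N) (n - t))"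
    have d: "norm ?d \<le> 1 * 1"
      unfolding norm_mult using c norm_comb_diff_le by (intro mult_mono) auto
    show ?case
    proof (cases "2 ^ N dvd n - t")
      case True
      with Suc d comb_diff_apply_eq_0[of N "n - t"] show ?thesis by simp
    next
      case False
      moreover have "(2 :: int) ^ N dvd 2 ^ Suc N" by simp
      ultimately have "\<not> 2 ^ Suc N dvd n - t" by (blast intro: dvd_trans)
      moreover have "?s (Suc N) = ?s N"
        using comb_diff_apply_eq_0[of N "n - t"] False by simp
      ultimately show ?thesis using Suc by metis
    qed
  qed simp
  then show "norm ((\<Sum>l<N. cscale (c l) (shift_by t (comb l - comb (Suc l)))) n) \<le> 1"
    by (simp add: linf_sum_apply cscale_apply shift_by_apply)
qed

text \<open>Testing \<open>\<phi>\<close> on the differences weighted by conjugate phases bounds the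
  sum of the moduli of its values, and the convergent series telescopes.\<close>

lemma convergent_dual_comb:
  assumes \<phi>: "\<phi> \<in> dual F"
  shows "convergent (\<lambda>j. \<phi> (shift_by t (comb j)))"
proof -
  obtain C where C: "0 \<le> C" "\<And>x. x \<in> F \<Longrightarrow> norm (\<phi> x) \<le> C * norm x"
    using dual_boundE[OF \<phi>] by blast
  define d where "d = (\<lambda>l. shift_by t (comb l - comb (Suc l)))"
  have d_F: "d l \<in> F" for l
    unfolding d_def by (intro shift_by_in_F F_diff comb_in_F)
  define g where "g = (\<lambda>l. \<phi> (d l))"
  have "summable (\<lambda>l. norm (g l))"
  proof (rule summableI_nonneg_bounded)
    fix N
    let ?w = "\<Sum>l<N. cscale (cnj (sgn (g l))) (d l)"
    have "(\<Sum>l<N. norm (g l)) = norm (of_real (\<Sum>l<N. norm (g l)) :: complex)"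
      unfolding norm_of_real by (simp add: sum_nonneg)
    also have "of_real (\<Sum>l<N. norm (g l)) = \<phi> ?w"
      unfolding dual_lin_sum[OF linf_subspace_F \<phi> d_F] of_real_sum g_def cnj_sgn_mult ..
    also have "norm (\<phi> ?w) \<le> C * norm ?w"
      by (intro C(2) F_sum F_scale d_F)
    also have "\<dots> \<le> C * 1"
      unfolding d_def by (intro mult_left_mono norm_comb_diff_sum_le norm_cnj_sgn_le C(1))
    finally show "(\<Sum>l<N. norm (g l)) \<le> C" by simp
  qed simp
  then have "convergent (\<lambda>N. \<Sum>l<N. g l)"
    using summable_norm_cancel summable_iff_convergent by blast
  then have "convergent (\<lambda>N. \<phi> (shift_by t (comb 0)) - (\<Sum>l<N. g l))"
    by (intro convergent_diff convergent_const)
  moreover have "g l = \<phi> (shift_by t (comb l)) - \<phi> (shift_by t (comb (Suc l)))" for l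
  proof -
    have "shift_by t (comb l) = d l + shift_by t (comb (Suc l))"
      by (rule bcontfun_eqI) (simp add: d_def shift_by_apply)
    then show ?thesis
      using \<phi> d_F[of l] shift_by_in_F[OF comb_in_F] by (simp add: dual_def g_def)
  qed
  then have "(\<lambda>N. \<phi> (shift_by t (comb 0)) - (\<Sum>l<N. g l)) = (\<lambda>N. \<phi> (shift_by t (comb N)))"
    by (simp add: sum_lessThan_telescope'[of "\<lambda>j. \<phi> (shift_by t (comb j))"])
  ultimately show ?thesis
    by (rule back_subst)
qed

lemma dual_spread:
  assumes "\<phi> \<in> dual F"
  shows "\<phi> (spread m j c) = (\<Sum>p\<in>{m..<m + 2 ^ j}. c p * \<phi> (shift_by p (comb j)))"
  unfolding spread_def
  by (rule dual_lin_sum[OF linf_subspace_F assms shift_by_in_F[OF comb_in_F]])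

lemma dual_spread_supported:
  assumes "\<phi> \<in> dual F" and "A \<subseteq> {m..<m + 2 ^ j}"
  shows "\<phi> (spread m j (\<lambda>p. if p \<in> A then c p else 0)) = (\<Sum>p\<in>A. c p * \<phi> (shift_by p (comb j)))"
proof -
  have "(\<Sum>p\<in>A. c p * \<phi> (shift_by p (comb j)))
    = (\<Sum>p\<in>{m..<m + 2 ^ j}. (if p \<in> A then c p else 0) * \<phi> (shift_by p (comb j)))"
    using assms(2) by (intro sum.mono_neutral_cong_left) auto
  then show ?thesis
    by (simp only: dual_spread[OF assms(1)])
qed

text \<open>For a finite set and a large \<open>j\<close>, translates weighted by conjugate phases
  stay in the unit ball. The resulting bound \<open>C\<close> survives the limit in
  \<open>j\<close>.\<close>

lemma lim_dual_comb_in_ell1: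
  assumes \<phi>: "\<phi> \<in> dual F"
    and lim: "\<And>t. (\<lambda>j. \<phi> (shift_by t (comb j))) \<longlonglongrightarrow> a t"
  shows "a \<in> ell1"
proof -
  obtain C where C: "0 \<le> C" "\<And>x. x \<in> F \<Longrightarrow> norm (\<phi> x) \<le> C * norm x"
    using dual_boundE[OF \<phi>] by blast
  have "(\<Sum>t\<in>A. norm (a t)) \<le> C" if fin: "finite A" for A
  proof -
    obtain m j0 where window: "\<And>j. j0 \<le> j \<Longrightarrow> A \<subseteq> {m..<m + 2 ^ j}"
      using finite_int_subset_window[OF fin] by meson
    have le: "(\<Sum>t\<in>A. norm (\<phi> (shift_by t (comb j)))) \<le> C" if j: "j0 \<le> j" for j
    proof -
      let ?c = "\<lambda>p. if p \<in> A then cnj (sgn (\<phi> (shift_by p (comb j)))) else 0"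
      have "(\<Sum>t\<in>A. norm (\<phi> (shift_by t (comb j))))
        = norm (of_real (\<Sum>t\<in>A. norm (\<phi> (shift_by t (comb j)))) :: complex)"
        unfolding norm_of_real by (simp add: sum_nonneg)
      also have "of_real (\<Sum>t\<in>A. norm (\<phi> (shift_by t (comb j)))) = \<phi> (spread m j ?c)"
        unfolding dual_spread_supported[OF \<phi> window[OF j]] of_real_sum cnj_sgn_mult ..
      also have "norm (\<phi> (spread m j ?c)) \<le> C * norm (spread m j ?c)"
        by (intro C(2) spread_in_F)
      also have "\<dots> \<le> C * 1"
        by (intro mult_left_mono norm_spread_le C(1)) (simp add: norm_sgn)
      finally show ?thesis by simp
    qed
    have "(\<lambda>j. \<Sum>t\<in>A. norm (\<phi> (shift_by t (comb j)))) \<longlonglongrightarrow> (\<Sum>t\<in>A. norm (a t))"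
      by (intro tendsto_sum tendsto_norm lim)
    then show ?thesis
      using le by (intro LIMSEQ_le_const2) auto
  qed
  then show ?thesis
    unfolding ell1_def mem_Collect_eq
    by (intro nonneg_bdd_above_summable_on) (auto simp: bdd_above_def)
qed

text \<open>On a fixed finite set the translate by \<open>t\<close> eventually equals the unit
  vector at \<open>t\<close>. Hence \<open>iota F a\<close> and the functional that defines
  \<open>a\<close> have the same limits.\<close>

lemma pairing_comb_tendsto:
  assumes a: "a \<in> ell1"
  shows "(\<lambda>j. pairing (shift_by t (comb j)) a) \<longlonglongrightarrow> a t"
proof (rule LIMSEQ_I)
  fix e :: real assume "0 < e"
  then have "0 < e / 4" by simp
  then obtain A where A: "finite A"
    "\<And>x :: linf. norm (pairing x a - (\<Sum>n\<in>A. x n * a n)) \<le> e / 4 * norm x"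
    "ell1_norm a \<le> (\<Sum>n\<in>A. norm (a n)) + e / 4"
    using pairing_approx[OF a] by metis
  obtain j0 m where window: "\<And>j. j0 \<le> j \<Longrightarrow> insert t A \<subseteq> {m..<m + 2 ^ j}"
    using finite_int_subset_window[of "insert t A"] A(1) by (metis finite_insert)
  have "norm (pairing (shift_by t (comb j)) a - a t) < e" if j: "j0 \<le> j" for j
  proof -
    let ?x = "shift_by t (comb j)"
    have x1: "norm ?x \<le> 1"
      unfolding norm_shift_by by (intro norm_bound norm_comb_apply_le)
    have x_apply: "?x n = (if n = t then 1 else 0)" if "n \<in> insert t A" for n
    proof (cases "n = t")
      case True
      then show ?thesis by (simp add: shift_by_apply comb_apply)
    next
      case False
      have "n \<in> {m..<m + 2 ^ j}" "t \<in> {m..<m + 2 ^ j}"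
        using window[OF j] that by auto
      then have "\<bar>n - t\<bar> < 2 ^ j" by auto
      with False have "\<not> 2 ^ j dvd n - t"
        using dvd_imp_le_int[of "n - t" "2 ^ j"] by auto
      with False show ?thesis by (simp add: shift_by_apply comb_apply)
    qed
    have *: "norm (pairing ?x a - (\<Sum>n\<in>A. ?x n * a n)) \<le> e / 4"
    proof -
      have "e / 4 * norm ?x \<le> e / 4 * 1"
        using x1 \<open>0 < e\<close> by (intro mult_left_mono) auto
      with A(2)[of ?x] show ?thesis by simp
    qed
    have sum: "(\<Sum>n\<in>A. ?x n * a n) = (if t \<in> A then a t else 0)"
    proof -
      have "(\<Sum>n\<in>A. ?x n * a n) = (\<Sum>n\<in>A. if n = t then a n else 0)"
        by (intro sum.cong) (auto simp: x_apply)
      then show ?thesis using A(1) by simp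
    qed
    \<comment> \<open>If \<open>t\<close> lies outside \<open>A\<close>, then \<open>a t\<close>
      belongs to the small tail.\<close>
    have "norm (a t) \<le> e / 4" if "t \<notin> A"
    proof -
      have "(\<Sum>n\<in>insert t A. norm (a n)) \<le> ell1_norm a"
        unfolding ell1_norm_def using A(1)
        by (intro finite_sum_le_infsum ell1_abs_summable a) auto
      with A(1,3) that show ?thesis by simp
    qed
    with * sum norm_triangle_ineq4[of "pairing ?x a" "a t"] \<open>0 < e\<close> show ?thesis
      by (auto split: if_splits)
  qed
  then show "\<exists>j0. \<forall>j\<ge>j0. norm (pairing (shift_by t (comb j)) a - a t) < e"
    by blast
qed

text \<open>\<open>x0_split\<close> moves the next \<open>i\<close> digits of the quotient into the
  coefficients, so a combination can be rewritten at any finer mesh.\<close>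

lemma spread_refine:
  "spread m j c = spread m (j + i) (\<lambda>p. c (m + (p - m) mod 2 ^ j) * x0 lam ((p - m) div 2 ^ j))"
proof (rule bcontfun_eqI)
  fix n
  define k where "k = n - m"
  have mod: "k mod 2 ^ (j + i) = 2 ^ j * (k div 2 ^ j mod 2 ^ i) + k mod 2 ^ j"
    by (simp add: power_add zmod_zmult2_eq)
  have div: "k mod 2 ^ (j + i) div 2 ^ j = k div 2 ^ j mod 2 ^ i"
    unfolding mod by simp
  have mod': "k mod 2 ^ (j + i) mod 2 ^ j = k mod 2 ^ j"
    unfolding mod by simp
  have "x0 lam (k div 2 ^ j) = x0 lam (k mod 2 ^ (j + i) div 2 ^ j) * x0 lam (k div 2 ^ (j + i))"
    unfolding div by (subst x0_split[of _ i]) (simp add: power_add zdiv_zmult2_eq)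
  then show "spread m j c n
    = spread m (j + i) (\<lambda>p. c (m + (p - m) mod 2 ^ j) * x0 lam ((p - m) div 2 ^ j)) n"
    unfolding spread_apply k_def[symmetric] by (simp add: mod')
qed

lemma spread_diff: "spread m j b - spread m j c = spread m j (\<lambda>p. b p - c p)"
  by (rule bcontfun_eqI) (simp add: spread_apply left_diff_distrib)

text \<open>
  Refining the mesh of a spread sequence and discarding its original base window changes the value
  of \<open>\<psi>\<close> by a null sequence, while the remaining coefficients shrink by the factor \<open>mu\<close>.
\<close>

lemma dual_spread_decay:
  assumes \<psi>: "\<psi> \<in> dual F"
    and lim: "\<And>t. (\<lambda>j. \<psi> (shift_by t (comb j))) \<longlonglongrightarrow> 0"
    and C: "0 \<le> C" "\<And>x. x \<in> F \<Longrightarrow> norm (\<psi> x) \<le> C * norm x"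
    and c: "\<And>p. norm (c p) \<le> B"
  shows "norm (\<psi> (spread m j c)) \<le> norm mu ^ r * C * B"
  using c
proof (induction r arbitrary: j c B)
  case 0
  have "norm (\<psi> (spread m j c)) \<le> C * norm (spread m j c)"
    by (intro C(2) spread_in_F)
  also have "\<dots> \<le> C * B"
    by (intro mult_left_mono norm_spread_le 0 C(1))
  finally show ?case by simp
next
  case (Suc r)
  let ?W = "{m..<m + 2 ^ j}"
  define b where "b = (\<lambda>p. if p \<in> ?W then c p else 0)"
  \<comment> \<open>On the base window the refined coefficients agree with \<open>c\<close>, so
    \<open>c'\<close> vanishes there. Elsewhere it carries a value of \<open>x0\<close> at a nonzero
    argument.\<close>
  define c' where "c' = (\<lambda>p. c (m + (p - m) mod 2 ^ j) * x0 lam ((p - m) div 2 ^ j) - b p)"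
  have "0 \<le> B" using Suc.prems norm_ge_zero order_trans by blast
  have c'_le: "norm (c' p) \<le> norm mu * B" for p
  proof (cases "p \<in> ?W")
    case True
    then have "c' p = 0" by (simp add: c'_def b_def)
    then show ?thesis using \<open>0 \<le> B\<close> by simp
  next
    case False
    have "(p - m) div 2 ^ j \<noteq> 0"
      using False zero_less_power[of "2 :: int" j] unfolding zdiv_eq_0_iff by (simp, linarith)
    then have "norm (c' p) \<le> B * norm mu"
      using False unfolding c'_def b_def
      by (simp only: if_False diff_zero norm_mult) (intro mult_mono Suc.prems norm_x0_le_mu, auto simp: \<open>0 \<le> B\<close>)
    then show ?thesis by (simp add: mult.commute)
  qed
  have "norm (\<psi> (spread m j c))
      \<le> norm mu ^ Suc r * C * B + norm (\<Sum>p\<in>?W. c p * \<psi> (shift_by p (comb (i + j))))" for i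
  proof -
    have "spread m j c = spread m (i + j) c' + spread m (i + j) b"
      using spread_diff[of m "i + j" _ b] spread_refine[of m j c i]
      by (simp add: c'_def add.commute flip: spread_diff)
    then have "\<psi> (spread m j c) = \<psi> (spread m (i + j) c') + \<psi> (spread m (i + j) b)"
      using \<psi> spread_in_F by (simp add: dual_def)
    moreover have "\<psi> (spread m (i + j) b) = (\<Sum>p\<in>?W. c p * \<psi> (shift_by p (comb (i + j))))"
      unfolding b_def by (rule dual_spread_supported[OF \<psi>]) (auto intro: order_less_le_trans power_increasing)
    moreover have "norm (\<psi> (spread m (i + j) c')) \<le> norm mu ^ r * C * (norm mu * B)"
      by (rule Suc.IH[OF c'_le])
    ultimately show ?thesis
      using norm_triangle_ineq[of "\<psi> (spread m (i + j) c')" "\<psi> (spread m (i + j) b)"]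
      by (simp add: mult_ac)
  qed
  \<comment> \<open>The window \<open>?W\<close> stays fixed while the mesh is refined, so the
    finite sum tends to 0.\<close>
  moreover have "(\<lambda>i. norm mu ^ Suc r * C * B + norm (\<Sum>p\<in>?W. c p * \<psi> (shift_by p (comb (i + j)))))
      \<longlonglongrightarrow> norm mu ^ Suc r * C * B + norm (\<Sum>p\<in>?W. c p * 0)"
    by (intro tendsto_intros LIMSEQ_ignore_initial_segment[OF lim])
  ultimately show ?case
    by (intro LIMSEQ_le_const[where X = "\<lambda>i. norm mu ^ Suc r * C * B
      + norm (\<Sum>p\<in>?W. c p * \<psi> (shift_by p (comb (i + j))))"]) auto
qed

text \<open>Letting \<open>r\<close> grow in the decay estimate kills \<open>\<psi>\<close> on the
  generators; linearity and continuity extend this to \<open>F\<close>.\<close>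

lemma dual_eq_0:
  assumes \<psi>: "\<psi> \<in> dual F"
    and lim: "\<And>t. (\<lambda>j. \<psi> (shift_by t (comb j))) \<longlonglongrightarrow> 0"
    and x: "x \<in> F"
  shows "\<psi> x = 0"
proof -
  obtain C where C: "0 \<le> C" "\<And>x. x \<in> F \<Longrightarrow> norm (\<psi> x) \<le> C * norm x"
    using dual_boundE[OF \<psi>] by blast
  have gen: "\<psi> (shift_by m (x0 lam)) = 0" for m
  proof -
    \<comment> \<open>At mesh 1 the window is the single point \<open>m\<close>.\<close>
    have "shift_by m (x0 lam) = spread m 0 (\<lambda>_. 1)"
      by (rule bcontfun_eqI) (simp add: shift_by_apply spread_apply)
    then have "norm (\<psi> (shift_by m (x0 lam))) \<le> norm mu ^ r * C * 1" for r
      using dual_spread_decay[OF \<psi> lim C, of "\<lambda>_. 1" 1 m 0 r] by simp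
    moreover have "(\<lambda>r. norm mu ^ r * C * 1) \<longlonglongrightarrow> 0 * C * 1"
      using norm_mu by (intro tendsto_intros LIMSEQ_power_zero) simp
    ultimately have "norm (\<psi> (shift_by m (x0 lam))) \<le> 0 * C * 1"
      by (intro LIMSEQ_le_const) auto
    then show ?thesis by simp
  qed
  let ?S = "linf.span (range (\<lambda>m. shift_by m (x0 lam)))"
  have add: "\<psi> (x + y) = \<psi> x + \<psi> y" and scale: "\<psi> (cscale c x) = c * \<psi> x"
    if "x \<in> F" "y \<in> F" for x y c
    using \<psi> that by (simp_all add: dual_def)
  have "linf.subspace {x \<in> F. \<psi> x = 0}"
  proof (rule linf.subspaceI)
    have "0 \<in> F" by (rule linf.subspace_0[OF linf_subspace_F])
    with scale[of 0 0 0] show "0 \<in> {x \<in> F. \<psi> x = 0}" by simp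
  qed (auto simp: add scale F_add F_scale)
  then have S: "?S \<subseteq> {x \<in> F. \<psi> x = 0}"
    using gen shift_by_x0_in_F by (intro linf.span_minimal) auto
  obtain f where f: "\<And>n. f n \<in> ?S" "f \<longlonglongrightarrow> x"
    using x unfolding F_space_def closure_sequential by blast
  have "norm (\<psi> x) \<le> C * norm (x - f n)" for n
  proof -
    have fn: "f n \<in> F" "\<psi> (f n) = 0" using S f(1) by auto
    then have "\<psi> x = \<psi> (x - f n)"
      using add[OF F_diff[OF x fn(1)] fn(1)] by simp
    then show ?thesis using C(2)[OF F_diff[OF x fn(1)]] by simp
  qed
  moreover have "(\<lambda>n. C * norm (x - f n)) \<longlonglongrightarrow> C * norm (x - x)"
    by (intro tendsto_intros f(2))
  ultimately have "norm (\<psi> x) \<le> C * norm (x - x)"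
    by (intro LIMSEQ_le_const) auto
  then show ?thesis by simp
qed

lemma iota_surj: "iota F ` ell1 = dual F"
proof (intro equalityI subsetI)
  fix \<phi> assume \<phi>: "\<phi> \<in> dual F"
  define a where "a = (\<lambda>t. lim (\<lambda>j. \<phi> (shift_by t (comb j))))"
  have lim: "(\<lambda>j. \<phi> (shift_by t (comb j))) \<longlonglongrightarrow> a t" for t
    unfolding a_def using convergent_dual_comb[OF \<phi>] by (simp add: convergent_LIMSEQ_iff)
  have a: "a \<in> ell1" by (rule lim_dual_comb_in_ell1[OF \<phi> lim])
  define \<psi> where "\<psi> = (\<lambda>x\<in>F. \<phi> x - iota F a x)"
  have \<psi>: "\<psi> \<in> dual F"
    unfolding \<psi>_def by (intro dual_diff \<phi> iota_in_dual linf_subspace_F a)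
  have "(\<lambda>j. \<psi> (shift_by t (comb j))) \<longlonglongrightarrow> 0" for t
    using tendsto_diff[OF lim pairing_comb_tendsto[OF a], of t t] shift_by_in_F[OF comb_in_F]
    by (simp add: \<psi>_def iota_def)
  then have "\<psi> x = 0" if "x \<in> F" for x
    using dual_eq_0[OF \<psi>] that by blast
  then have "\<phi> = iota F a"
    using \<phi> by (intro extensionalityI[of _ F]) (auto simp: \<psi>_def iota_def dual_def)
  with a show "\<phi> \<in> iota F ` ell1" by blast
qed (auto intro: iota_in_dual linf_subspace_F)

lemma shift_invariant_predual_F: "shift_invariant_predual F"
proof -
  have "Metric_space12 ell1 ell1_dist (dual F) (dual_dist F)"
    by (intro Metric_space12.intro Metric_space_ell1 Metric_space_dual linf_subspace_F)
  then have "homeomorphic_map (Metric_space.mtopology ell1 ell1_dist)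
      (Metric_space.mtopology (dual F) (dual_dist F)) (iota F)"
    by (rule Metric_space12.isometry_imp_homeomorphic_map) (simp_all add: iota_surj iota_isometry)
  then show ?thesis
    unfolding shift_invariant_predual_def concrete_predual_def
    using linf_subspace_F closed_F shift_image_F
    by (auto simp: iota_def pairing_add_right pairing_scale_right intro!: restrict_ext)
qed

end

theorem theorem3p4:
  fixes lam :: complex
  assumes "norm lam > 1"
  shows "shift_invariant_predual (F_space lam) \<and>
    F_space lam = {x :: int \<Rightarrow>\<^sub>C complex.
      (\<forall>k\<ge>1. \<forall>t. \<forall>U\<in>X k t. beta_eval x U = lam powi (- int k) * x t) \<and>
      (\<forall>U\<in>X_inf. beta_eval x U = 0)}"
proof -
  interpret binary_weight lam
    by unfold_locales (rule assms)
  have "lam powi (- int k) = mu ^ k" for k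
    by (simp add: power_int_minus power_inverse)
  then show ?thesis
    using shift_invariant_predual_F F_eq_limit_space by (simp add: limit_space_def)
qed

end
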